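(* Let $(l,Q,\omega,\varphi)$ be admissible data (see context). For every $m\in(0,1)$ and $s\in(0,\infty)$ there exists a function $w_{m,s}$ such that $$sc^-G_{m,s}(w_{m,s})=\inf_{w\in L^1((2m-1,1))}sc^-G_{m,s}(w).$$ Moreover, $w_{m,s}$ is the unique minimizer of $sc^-G_{m,s}$ on $L^1((2m-1,1))$, $w_{m,s}\in SBV((2m-1,1))$, it is strictly increasing and odd symmetric with respect to $t=m$ (that is, $w_{m,s}(2m-t)=s-w_{m,s}(t)$ for a.e. $t$), $w_{m,s}(2m-1)=0$, $w_{m,s}(1)=s$ (in the sense of traces), and for a unique $\lambda_{m,s}\in(0,\vartheta^{1/2}(m)]$ $$w_{m,s}'(t)=\left(\frac{\lambda_{m,s}^2\,\omega_m(1-t)}{\vartheta_m(t)\,(\vartheta_m(t)-\lambda_{m,s}^2)}\right)^{1/2}\quad\text{for }\mathcal L^1\text{-a.e. }t\in(2m-1,1),$$ and either (1) $w_{m,s}\in W^{1,1}((2m-1,1))$, with $w_{m,s}(m)=\frac s2$; or (2) $w_{m,s}\in SBV((2m-1,1))$, with the jump part $D^jw_{m,s}$ of its derivative concentrated on $t=m$, and $\lambda_{m,s}=\vartheta^{1/2}(m)$.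
   Context: Convention: $0\cdot\infty=0$. Admissible data: $l,Q\in C^0([0,1],[0,\infty))$ with $l(1)=1$, $l^{-1}(\{0\})=Q^{-1}(\{0\})=\{0\}$, $Q$ increasing in a right neighbourhood of $0$, and $t\mapsto (l(t)/Q(1-t))^{1/2}$ (on $[0,1)$) increasing in a right neighbourhood of $0$; $\omega\in C^0([0,1],[0,\infty))$ with $\omega^{-1}(\{0\})=\{0\}$ such that the limit $\bar\varsigma:=\lim_{t\to0^+}(\omega(t)/Q(t))^{1/2}\in[0,\infty]$ exists; $\varphi\in C^0([0,\infty),[0,\infty))$ non-decreasing with $\lim_{t\to\infty}\varphi(t)\in(0,\infty)$, $\varphi^{-1}(0)=\{0\}$, right-differentiable at $0$ with $\varphi'(0^+)=1$; and the function $\vartheta(t):=\frac{\omega(1-t)}{Q(1-t)}l(t)$ is strictly increasing on $[0,1)$. Then $\vartheta$ is continuous, $\vartheta(0)=0$ and $\vartheta(1^-)=\bar\varsigma^2\in(0,\infty]$; set $\vartheta(1):=\vartheta(1^-)$. For $m\in(0,1)$, $t\in[2m-1,1]$: $\vartheta_m(t):=\vartheta(m+|t-m|)$, $\omega_m(1-t):=\omega(1-m-|t-m|)$. $G_{m,s}:L^1((2m-1,1))\to[0,\infty]$ is $G_{m,s}(w):=\int_{2m-1}^1(\vartheta_m(t)|w'|^2+\omega_m(1-t))^{1/2}dt$ if $w\in W^{1,1}((2m-1,1))$ with $w(2m-1)=0$, $w(1)=s$, and $\infty$ otherwise. Its $L^1$-lower semicontinuous envelope is $$sc^-G_{m,s}(w)=\int_{2m-1}^1\big(\vartheta_m(t)|w'|^2+\omega_m(1-t)\big)^{1/2}dt+\int_{2m-1}^1\vartheta_m^{1/2}\,d|D^sw|+\vartheta^{1/2}(1^-)|w((2m-1)^+)|+\vartheta^{1/2}(1^-)|w(1^-)-s|$$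 for $w\in BV((2m-1,1))$ ($w'$ the density of the absolutely continuous part and $D^sw$ the singular part of $Dw$), and $+\infty$ otherwise. *)

theory Defs
  imports "HOL-Analysis.Analysis"
begin

section \<open>Admissible data\<close>

definition theta ::
  "(real \<Rightarrow> real) \<Rightarrow> (real \<Rightarrow> real) \<Rightarrow> (real \<Rightarrow> real) \<Rightarrow> real \<Rightarrow> real" where
  "theta l Q \<omega> t = \<omega> (1 - t) / Q (1 - t) * l t"

text \<open>Functions on an interval are total functions of which only the restriction to that interval
  matters.  The monotonicity conditions called ``increasing'' are read in the weak sense, which is
  the more general hypothesis.\<close>

definition admissible_data ::
  "(real \<Rightarrow> real) \<Rightarrow> (real \<Rightarrow> real) \<Rightarrow> (real \<Rightarrow> real) \<Rightarrow> (real \<Rightarrow> real) \<Rightarrow> bool" where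
  "admissible_data l Q \<omega> \<phi> \<longleftrightarrow>
     continuous_on {0..1} l \<and> l ` {0..1} \<subseteq> {0..} \<and>
     continuous_on {0..1} Q \<and> Q ` {0..1} \<subseteq> {0..} \<and>
     l 1 = 1 \<and>
     {t \<in> {0..1}. l t = 0} = {0} \<and> {t \<in> {0..1}. Q t = 0} = {0} \<and>
     (\<exists>\<delta>\<in>{0<..1}. mono_on {0..<\<delta>} Q) \<and>
     (\<exists>\<delta>\<in>{0<..1}. mono_on {0..<\<delta>} (\<lambda>t. sqrt (l t / Q (1 - t)))) \<and>
     continuous_on {0..1} \<omega> \<and> \<omega> ` {0..1} \<subseteq> {0..} \<and>
     {t \<in> {0..1}. \<omega> t = 0} = {0} \<and>
     (\<exists>\<zeta>::ereal. ((\<lambda>t. ereal (sqrt (\<omega> t / Q t))) \<longlongrightarrow> \<zeta>) (at_right 0)) \<and>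
     continuous_on {0..} \<phi> \<and> \<phi> ` {0..} \<subseteq> {0..} \<and>
     mono_on {0..} \<phi> \<and> (\<exists>L>0. (\<phi> \<longlongrightarrow> L) at_top) \<and>
     {t \<in> {0..}. \<phi> t = 0} = {0} \<and>
     (\<phi> has_real_derivative 1) (at_right 0) \<and>
     strict_mono_on {0..<1} (theta l Q \<omega>)"

text \<open>At the two end points \<open>t = 2m - 1\<close> and \<open>t = 1\<close> the real number \<open>theta_m l Q \<omega> m t\<close> is not the
  limit \<open>\<vartheta>(1\<^sup>-)\<close>, which may be infinite.  Below, \<open>theta_m\<close> is only used on the open interval.\<close>

definition theta_m ::
  "(real \<Rightarrow> real) \<Rightarrow> (real \<Rightarrow> real) \<Rightarrow> (real \<Rightarrow> real) \<Rightarrow> real \<Rightarrow> real \<Rightarrow> real" where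
  "theta_m l Q \<omega> m t = theta l Q \<omega> (m + \<bar>t - m\<bar>)"

text \<open>The argument is \<open>\<tau> = 1 - t\<close>, so that \<open>omega_m \<omega> m (1 - t) = \<omega> (1 - m - \<bar>t - m\<bar>)\<close>.\<close>

definition omega_m :: "(real \<Rightarrow> real) \<Rightarrow> real \<Rightarrow> real \<Rightarrow> real" where
  "omega_m \<omega> m \<tau> = \<omega> (1 - m - \<bar>(1 - \<tau>) - m\<bar>)"


section \<open>Sobolev and BV functions of one variable\<close>

text \<open>Elements of \<open>L\<^sup>1(I)\<close> are represented by functions; equality in \<open>L\<^sup>1(I)\<close> is equality almost
  everywhere.\<close>

definition L1 :: "real set \<Rightarrow> (real \<Rightarrow> real) set" where
  "L1 I = {w. integrable (lebesgue_on I) w}"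

definition L1_dist :: "real set \<Rightarrow> (real \<Rightarrow> real) \<Rightarrow> (real \<Rightarrow> real) \<Rightarrow> real" where
  "L1_dist I v w = (\<integral>t. \<bar>v t - w t\<bar> \<partial>lebesgue_on I)"

definition C1c :: "real set \<Rightarrow> (real \<Rightarrow> real) set" where
  "C1c I = {\<psi>. \<psi> C1_differentiable_on UNIV \<and>
               compact (closure {t. \<psi> t \<noteq> 0}) \<and> closure {t. \<psi> t \<noteq> 0} \<subseteq> I}"

definition has_weak_deriv :: "real set \<Rightarrow> (real \<Rightarrow> real) \<Rightarrow> (real \<Rightarrow> real) \<Rightarrow> bool" where
  "has_weak_deriv I w g \<longleftrightarrow> g \<in> L1 I \<and>
     (\<forall>\<psi>\<in>C1c I. (\<integral>t. w t * deriv \<psi> t \<partial>lebesgue_on I) = - (\<integral>t. g t * \<psi> t \<partial>lebesgue_on I))"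

definition W11 :: "real set \<Rightarrow> (real \<Rightarrow> real) set" where
  "W11 I = {w \<in> L1 I. \<exists>g. has_weak_deriv I w g}"

text \<open>A choice among almost everywhere equal functions; meaningful only on \<open>W11 I\<close>.\<close>

definition weak_deriv :: "real set \<Rightarrow> (real \<Rightarrow> real) \<Rightarrow> real \<Rightarrow> real" where
  "weak_deriv I w = (SOME g. has_weak_deriv I w g)"

text \<open>One-sided traces, as essential one-sided limits.  They do not depend on the representative; on
  \<open>W\<^sup>1\<^sup>,\<^sup>1\<close> they are the end point values of the continuous representative.\<close>

definition trace_right :: "(real \<Rightarrow> real) \<Rightarrow> real \<Rightarrow> real \<Rightarrow> bool" where
  "trace_right w a c \<longleftrightarrow>
     (\<forall>e>0. \<exists>d>0. AE t in lebesgue. a < t \<and> t < a + d \<longrightarrow> \<bar>w t - c\<bar> < e)"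

definition trace_left :: "(real \<Rightarrow> real) \<Rightarrow> real \<Rightarrow> real \<Rightarrow> bool" where
  "trace_left w b c \<longleftrightarrow>
     (\<forall>e>0. \<exists>d>0. AE t in lebesgue. b - d < t \<and> t < b \<longrightarrow> \<bar>w t - c\<bar> < e)"

text \<open>\<open>has_BV_deriv I w g \<mu> \<sigma>\<close>: the distributional derivative of \<open>w\<close> on \<open>I\<close> is the finite signed
  measure \<open>Dw = g \<L>\<^sup>1 + D\<^sup>sw\<close>, where \<open>D\<^sup>sw\<close> is singular with respect to \<open>\<L>\<^sup>1\<close> and is given through its
  polar decomposition \<open>D\<^sup>sw = \<sigma> \<mu>\<close> with \<open>\<mu> = \<bar>D\<^sup>sw\<bar>\<close> and \<open>\<bar>\<sigma>\<bar> = 1\<close>.  Every finite signed Borel measure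
  has such a decomposition, and \<open>g\<close>, \<open>\<mu>\<close>, \<open>\<sigma>\<close> are unique up to null sets.\<close>

definition has_BV_deriv ::
  "real set \<Rightarrow> (real \<Rightarrow> real) \<Rightarrow> (real \<Rightarrow> real) \<Rightarrow> real measure \<Rightarrow> (real \<Rightarrow> real) \<Rightarrow> bool" where
  "has_BV_deriv I w g \<mu> \<sigma> \<longleftrightarrow>
     g \<in> L1 I \<and>
     sets \<mu> = sets (restrict_space borel I) \<and> finite_measure \<mu> \<and>
     (\<exists>N\<in>null_sets lborel. N \<subseteq> I \<and> emeasure \<mu> (I - N) = 0) \<and>
     \<sigma> \<in> borel_measurable \<mu> \<and> (\<forall>t\<in>I. \<bar>\<sigma> t\<bar> = 1) \<and>
     (\<forall>\<psi>\<in>C1c I. (\<integral>t. w t * deriv \<psi> t \<partial>lebesgue_on I)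
        = - ((\<integral>t. g t * \<psi> t \<partial>lebesgue_on I) + (\<integral>t. \<psi> t * \<sigma> t \<partial>\<mu>)))"

text \<open>With \<open>\<mu> = \<bar>D\<^sup>sw\<bar>\<close> and \<open>A\<close> the (countable) set of its atoms, the jump part \<open>D\<^sup>jw\<close> is the
  restriction of \<open>D\<^sup>sw\<close> to \<open>A\<close> and the Cantor part \<open>D\<^sup>cw\<close> the restriction to the complement of \<open>A\<close>.
  The next two measures are \<open>\<bar>D\<^sup>jw\<bar>\<close> and \<open>\<bar>D\<^sup>cw\<bar>\<close>.\<close>

definition atoms :: "real measure \<Rightarrow> real set" where
  "atoms \<mu> = {t \<in> space \<mu>. emeasure \<mu> {t} \<noteq> 0}"

definition jump_variation :: "real measure \<Rightarrow> real measure" where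
  "jump_variation \<mu> = density \<mu> (indicator (atoms \<mu>))"

definition cantor_variation :: "real measure \<Rightarrow> real measure" where
  "cantor_variation \<mu> = density \<mu> (indicator (space \<mu> - atoms \<mu>))"

definition SBV :: "real set \<Rightarrow> (real \<Rightarrow> real) set" where
  "SBV I = {w \<in> L1 I. \<exists>g \<mu> \<sigma>. has_BV_deriv I w g \<mu> \<sigma> \<and> emeasure (cantor_variation \<mu>) I = 0}"


section \<open>The functional and its relaxation\<close>

definition lsc_on_L1 :: "real set \<Rightarrow> ((real \<Rightarrow> real) \<Rightarrow> ennreal) \<Rightarrow> bool" where
  "lsc_on_L1 I F \<longleftrightarrow>
     (\<forall>w\<in>L1 I. \<forall>c<F w. \<exists>e>0. \<forall>v\<in>L1 I. L1_dist I v w < e \<longrightarrow> c < F v)"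

definition lsc_envelope ::
  "real set \<Rightarrow> ((real \<Rightarrow> real) \<Rightarrow> ennreal) \<Rightarrow> (real \<Rightarrow> real) \<Rightarrow> ennreal" where
  "lsc_envelope I F w = (SUP H\<in>{H. lsc_on_L1 I H \<and> (\<forall>v\<in>L1 I. H v \<le> F v)}. H w)"

abbreviation interval_m :: "real \<Rightarrow> real set" where
  "interval_m m \<equiv> {2 * m - 1<..<1}"

definition G_ms ::
  "(real \<Rightarrow> real) \<Rightarrow> (real \<Rightarrow> real) \<Rightarrow> (real \<Rightarrow> real) \<Rightarrow> real \<Rightarrow> real \<Rightarrow> (real \<Rightarrow> real) \<Rightarrow> ennreal" where
  "G_ms l Q \<omega> m s w =
     (if w \<in> W11 (interval_m m) \<and> trace_right w (2 * m - 1) 0 \<and> trace_left w 1 s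
      then \<integral>\<^sup>+ t. ennreal (sqrt (theta_m l Q \<omega> m t * \<bar>weak_deriv (interval_m m) w t\<bar>\<^sup>2
                                + omega_m \<omega> m (1 - t))) \<partial>lebesgue_on (interval_m m)
      else \<infinity>)"

text \<open>The relaxation is the \<open>L\<^sup>1\<close>-lower semicontinuous envelope itself.  The integral representation
  of it on \<open>BV\<close> (bulk term, \<open>\<bar>D\<^sup>sw\<bar>\<close> term and boundary terms with the possibly infinite weight
  \<open>\<vartheta>\<^sup>1\<^sup>/\<^sup>2(1\<^sup>-)\<close>, where \<open>0 \<cdot> \<infinity> = 0\<close>) is a property of this envelope and is not built into the
  definition.\<close>

definition sc_G_ms ::
  "(real \<Rightarrow> real) \<Rightarrow> (real \<Rightarrow> real) \<Rightarrow> (real \<Rightarrow> real) \<Rightarrow> real \<Rightarrow> real \<Rightarrow> (real \<Rightarrow> real) \<Rightarrow> ennreal" where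
  "sc_G_ms l Q \<omega> m s = lsc_envelope (interval_m m) (G_ms l Q \<omega> m s)"

text \<open>\<open>\<kappa>\<close> is the parameter \<open>\<lambda>\<^sub>m\<^sub>,\<^sub>s\<close>.\<close>

definition w_deriv_formula ::
  "(real \<Rightarrow> real) \<Rightarrow> (real \<Rightarrow> real) \<Rightarrow> (real \<Rightarrow> real) \<Rightarrow> real \<Rightarrow> real \<Rightarrow> real \<Rightarrow> real" where
  "w_deriv_formula l Q \<omega> m \<kappa> t =
     sqrt (\<kappa>\<^sup>2 * omega_m \<omega> m (1 - t)
             / (theta_m l Q \<omega> m t * (theta_m l Q \<omega> m t - \<kappa>\<^sup>2)))"

end

theory Submission
  imports Defs
begin

text \<open>Write \<open>A\<close> and \<open>B\<close> for \<open>\<vartheta>\<^sub>m\<close> and \<open>\<omega>\<^sub>m(1 - \<cdot>)\<close>, and let \<open>0 \<le> k\<close>, \<open>k\<^sup>2 \<le> A(m) = min A\<close>.  By Cauchy-Schwarz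
  in the plane, \<open>sqrt (A x\<^sup>2 + B) \<ge> k x + sqrt (B (1 - k\<^sup>2/A))\<close> with equality exactly at the slope of the
  theorem with parameter \<open>k\<close>; integrating, every competitor has energy at least
  \<open>E = k s + \<integral> sqrt (B (1 - k\<^sup>2/A))\<close>, and a constant lower bound passes to the envelope.  The integral of
  the slope increases continuously with \<open>k\<close>, so either it equals \<open>s\<close> for some \<open>k\<close>, or it stays below
  \<open>s\<close> up to \<open>k = sqrt (A m)\<close>, and then a jump at \<open>m\<close> makes up the difference.  Spreading the jump over
  a short interval gives competitors whose energy tends to \<open>E\<close>.  For uniqueness, the deficit in the
  Cauchy-Schwarz inequality controls the distance of \<open>w'\<close> from the slope away from \<open>m\<close>, so a
  neighbourhood in \<open>L\<^sup>1\<close> of any \<open>u\<close> other than the minimizer contains no competitor of energy close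
  to \<open>E\<close>; the envelope at \<open>u\<close> then exceeds \<open>E\<close>.\<close>

section \<open>Sobolev functions on an interval\<close>

lemma L1_iff: "f \<in> L1 {a<..<b} \<longleftrightarrow> f absolutely_integrable_on {a..b}"
  unfolding L1_def absolutely_integrable_on_Icc_iff_Ioo
  by (simp add: set_integrable_def integrable_restrict_space)

lemma integral_L1:
  fixes f :: "real \<Rightarrow> real"
  assumes "f \<in> L1 {a<..<b}"
  shows "(\<integral>t. f t \<partial>lebesgue_on {a<..<b}) = integral {a..b} f"
  using lebesgue_integral_eq_integral[of "{a<..<b}" f] assms
  by (simp add: L1_def integral_open_interval_real)

lemma L1_integrable_subinterval:
  assumes "f \<in> L1 {a<..<b}" "a \<le> c" "d \<le> b"
  shows "f integrable_on {c..d}"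
proof (rule integrable_on_subinterval)
  show "f integrable_on {a..b}"
    using assms(1) unfolding L1_iff by (rule set_lebesgue_integral_eq_integral)
qed (use assms in auto)

lemma AE_on_Ioo_iff:
  fixes a b :: real
  shows "(AE t in lebesgue_on {a<..<b}. P t) \<longleftrightarrow> (AE t in lebesgue. a < t \<and> t < b \<longrightarrow> P t)"
  by (simp add: AE_restrict_space_iff)

text \<open>By Lebesgue differentiation, almost every value of \<open>f\<close> is the limit of its
  means over \<open>{t..t + h}\<close>, and all these means vanish.\<close>

lemma AE_eq_0_if_integrals_eq_0:
  fixes f :: "real \<Rightarrow> real"
  assumes f: "f \<in> L1 {a<..<b}" and 0: "\<And>x y. a < x \<Longrightarrow> x < y \<Longrightarrow> y < b \<Longrightarrow> integral {x..y} f = 0"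
  shows "AE t in lebesgue_on {a<..<b}. f t = 0"
proof -
  \<comment> \<open>Truncation outside \<open>{a..b}\<close> makes the function integrable on every
    box, as the differentiation theorem asks.\<close>
  define F where "F t = (if t \<in> {a..b} then f t else 0)" for t
  have "F integrable_on UNIV"
    using f integrable_restrict_UNIV[of "{a..b}" f]
    by (simp add: F_def[abs_def] L1_iff absolutely_integrable_on_def)
  then have "F integrable_on cbox c d" for c d
    using integrable_on_subcbox by blast
  then obtain N where N: "negligible N" and
    lim: "\<And>x e. \<lbrakk>x \<notin> N; 0 < e\<rbrakk> \<Longrightarrow> \<exists>d>0. \<forall>h. 0 < h \<and> h < d \<longrightarrow>
      \<bar>inverse h * integral {x..x + h} F - F x\<bar> < e"
    by (rule integrable_ccontinuous_explicit[of F]) (auto simp: divide_inverse)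
  have "f t = 0" if t: "t \<notin> N" "a < t" "t < b" for t
  proof (rule ccontr)
    assume "f t \<noteq> 0"
    then obtain d where d: "d > 0" and small: "\<And>h. 0 < h \<Longrightarrow> h < d \<Longrightarrow>
        \<bar>inverse h * integral {t..t + h} F - F t\<bar> < \<bar>f t\<bar>"
      using lim[OF t(1), of "\<bar>f t\<bar>"] by auto
    define h where "h = min d (b - t) / 2"
    have h: "0 < h" "h < d" "t + h < b"
      using d t by (auto simp: h_def min_def field_simps)
    have "integral {t..t + h} F = integral {t..t + h} f"
      using t h by (auto simp: F_def intro!: integral_cong)
    also have "\<dots> = 0"
      using t h by (intro 0) auto
    finally show False
      using small[OF h(1,2)] t by (simp add: F_def)
  qed
  then have "{t. \<not> (a < t \<and> t < b \<longrightarrow> f t = 0)} \<subseteq> N"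
    by auto
  with N show ?thesis
    unfolding AE_on_Ioo_iff eventually_ae_filter_negligible by blast
qed

section \<open>Test functions of compact support\<close>

lemma C1cD:
  assumes "\<psi> \<in> C1c {a<..<b}"
  shows "(\<psi> has_real_derivative deriv \<psi> t) (at t)" "continuous_on UNIV (deriv \<psi>)"
    "continuous_on UNIV \<psi>"
    "t \<notin> {a<..<b} \<Longrightarrow> \<psi> t = 0" "t \<notin> {a<..<b} \<Longrightarrow> deriv \<psi> t = 0"
proof -
  let ?S = "closure {t. \<psi> t \<noteq> 0}"
  obtain D where D: "\<And>t. (\<psi> has_vector_derivative D t) (at t)" "continuous_on UNIV D"
    and S: "?S \<subseteq> {a<..<b}"
    using assms by (auto simp: C1c_def C1_differentiable_on_def)
  have d: "(\<psi> has_real_derivative D t) (at t)" for t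
    using D(1) by (simp add: has_real_derivative_iff_has_vector_derivative)
  then have "deriv \<psi> = D"
    by (auto intro: DERIV_imp_deriv)
  with d D(2) show "(\<psi> has_real_derivative deriv \<psi> t) (at t)" "continuous_on UNIV (deriv \<psi>)" for t
    by auto
  show "continuous_on UNIV \<psi>"
    using d by (meson DERIV_isCont continuous_at_imp_continuous_on)
  have out: "\<psi> t = 0" if "t \<notin> ?S" for t
    using that closure_subset[of "{t. \<psi> t \<noteq> 0}"] by auto
  show "\<psi> t = 0" if "t \<notin> {a<..<b}" for t
    using that S out by blast
  \<comment> \<open>The complement of the closed support is an open set on which
    \<open>\<psi>\<close> is 0, and it contains every outside point, the end points of the interval
    included.\<close>
  show "deriv \<psi> t = 0" if "t \<notin> {a<..<b}" for t
  proof -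
    have "open (- ?S)" "t \<in> - ?S"
      using that S by blast+
    then have "(\<psi> has_real_derivative 0) (at t)"
      by (rule has_field_derivative_transform_within_open[where f="\<lambda>_. 0", OF DERIV_const])
        (rule out[symmetric], simp)
    then show ?thesis
      by (rule DERIV_imp_deriv)
  qed
qed

lemma C1cI:
  assumes d: "\<And>t. (\<psi> has_real_derivative D t) (at t)" and D: "continuous_on UNIV D"
    and 0: "\<And>t. t \<notin> {c..d} \<Longrightarrow> \<psi> t = 0" and cd: "a < c" "d < b"
  shows "\<psi> \<in> C1c {a<..<b}"
proof -
  have S: "closure {t. \<psi> t \<noteq> 0} \<subseteq> {c..d}"
    using 0 by (intro closure_minimal) blast+
  then have "compact (closure {t. \<psi> t \<noteq> 0})"
    by (meson bounded_closed_interval bounded_subset closed_closure compact_eq_bounded_closed)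
  moreover have "\<psi> C1_differentiable_on UNIV"
    using d D by (auto simp: C1_differentiable_on_def has_real_derivative_iff_has_vector_derivative)
  ultimately show ?thesis
    using S cd by (force simp: C1c_def)
qed

text \<open>The extreme points of the compact support serve as \<open>c\<close> and
  \<open>d\<close>; an empty support leaves the choice free, and the midpoint is taken.\<close>

lemma C1c_support:
  assumes "\<psi> \<in> C1c {a<..<b}" "a < b"
  obtains c d where "a < c" "c \<le> d" "d < b" "\<And>t. t \<notin> {c..d} \<Longrightarrow> \<psi> t = 0"
proof (cases "closure {t. \<psi> t \<noteq> 0} = {}")
  case True
  then have "\<And>t. \<psi> t = 0"
    by auto
  with \<open>a < b\<close> show ?thesis
    by (intro that[of "(a+b)/2" "(a+b)/2"]) auto
next
  case False
  let ?S = "closure {t. \<psi> t \<noteq> 0}"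
  have S: "compact ?S" "?S \<subseteq> {a<..<b}"
    using assms by (auto simp: C1c_def)
  obtain c where c: "c \<in> ?S" "\<And>t. t \<in> ?S \<Longrightarrow> c \<le> t"
    using compact_attains_inf[OF S(1) False] by blast
  obtain d where d: "d \<in> ?S" "\<And>t. t \<in> ?S \<Longrightarrow> t \<le> d"
    using compact_attains_sup[OF S(1) False] by blast
  have "\<psi> t = 0" if "t \<notin> {c..d}" for t
    using that c d closure_subset[of "{t. \<psi> t \<noteq> 0}"] by (auto simp: subset_eq)
  moreover have "a < c" "c \<le> d" "d < b"
    using c(1) d(1) S(2) c(2)[OF d(1)] by auto
  ultimately show ?thesis
    by (intro that[of c d])
qed

text \<open>The bumps are \<open>k q / (1 + k q)\<close>, where \<open>q\<close> is the square of the positive part of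
  \<open>(t - x) (y - t)\<close>.\<close>

lemma C1c_bumps:
  assumes xy: "a < x" "x < y" "y < b"
  obtains \<psi> :: "nat \<Rightarrow> real \<Rightarrow> real" where "\<And>n. \<psi> n \<in> C1c {a<..<b}"
    "\<And>n t. \<bar>\<psi> n t\<bar> \<le> 1" "\<And>t. (\<lambda>n. \<psi> n t) \<longlonglongrightarrow> indicator {x<..<y} t"
proof -
  define p where "p t = max 0 ((t - x) * (y - t))" for t
  define q where "q t = (p t)\<^sup>2" for t
  define \<psi> where "\<psi> n t = real n * q t / (1 + real n * q t)" for n t
  have pos: "1 + real n * q t > 0" for n t
    by (simp add: q_def add_pos_nonneg)
  have p_out: "p t = 0 \<longleftrightarrow> t \<notin> {x<..<y}" for t
  proof -
    have "p t = 0 \<longleftrightarrow> (t - x) * (y - t) \<le> 0"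
      by (simp add: p_def max_def)
    also have "\<dots> \<longleftrightarrow> t \<notin> {x<..<y}"
      using xy by (simp add: mult_le_0_iff) linarith
    finally show ?thesis .
  qed
  \<comment> \<open>The square of the positive part is differentiable also at 0, where its
    difference quotient is at most \<open>\<bar>h\<bar>\<close>; this makes \<open>q\<close>, and
    hence the bumps, continuously differentiable.\<close>
  have max2: "((\<lambda>r::real. (max 0 r)\<^sup>2) has_real_derivative 2 * max 0 r) (at r)" for r
  proof -
    consider "r < 0" | "r = 0" | "r > 0" by linarith
    then show ?thesis
    proof cases
      case 1
      have "((\<lambda>r::real. (max 0 r)\<^sup>2) has_real_derivative 0) (at r)"
        by (rule has_field_derivative_transform_within_open[where f="\<lambda>_. 0" and S="{..<0}"])
          (use 1 in \<open>auto simp: max_def\<close>)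
      then show ?thesis using 1 by (simp add: max_def)
    next
      case 2
      have "((\<lambda>h::real. (max 0 h)\<^sup>2 / h) \<longlongrightarrow> 0) (at 0)"
      proof (rule Lim_null_comparison)
        show "\<forall>\<^sub>F h in at 0. norm ((max 0 h)\<^sup>2 / h) \<le> \<bar>h::real\<bar>"
          by (intro always_eventually) (auto simp: max_def power2_eq_square)
      qed (auto intro!: tendsto_eq_intros)
      then show ?thesis using 2 by (simp add: DERIV_def)
    next
      case 3
      have "((\<lambda>r::real. (max 0 r)\<^sup>2) has_real_derivative 2 * r) (at r)"
        by (rule has_field_derivative_transform_within_open[where f="\<lambda>r. r\<^sup>2" and S="{0<..}"])
          (use 3 in \<open>auto simp: max_def intro!: derivative_eq_intros\<close>)
      then show ?thesis using 3 by (simp add: max_def)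
    qed
  qed
  define D where "D t = 2 * p t * (x + y - 2 * t)" for t
  have dq: "(q has_real_derivative D t) (at t)" for t
  proof -
    have "((\<lambda>t. (t - x) * (y - t)) has_real_derivative (x + y - 2 * t)) (at t)"
      by (auto intro!: derivative_eq_intros)
    from DERIV_chain2[OF max2 this] show ?thesis
      by (simp add: q_def[abs_def] p_def D_def)
  qed
  have cp: "continuous_on UNIV p"
    unfolding p_def by (intro continuous_intros)
  then have cD: "continuous_on UNIV D"
    unfolding D_def by (intro continuous_intros)
  have cq: "continuous_on UNIV q"
    unfolding q_def by (intro continuous_intros cp)
  have "\<psi> n \<in> C1c {a<..<b}" for n
  proof (rule C1cI)
    show "(\<psi> n has_real_derivative real n * D t / (1 + real n * q t)\<^sup>2) (at t)" for t
      unfolding \<psi>_def using pos[of n t]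
      by (auto intro!: derivative_eq_intros dq simp: algebra_simps power2_eq_square)
    show "continuous_on UNIV (\<lambda>t. real n * D t / (1 + real n * q t)\<^sup>2)"
      using pos by (intro continuous_intros cD cq) (metis less_irrefl zero_eq_power2)
    show "\<psi> n t = 0" if "t \<notin> {x..y}" for t
      using p_out[of t] that by (auto simp: \<psi>_def q_def)
  qed (use xy in auto)
  moreover have "\<bar>\<psi> n t\<bar> \<le> 1" for n t
    using pos[of n t] by (simp add: \<psi>_def q_def)
  moreover have "(\<lambda>n. \<psi> n t) \<longlonglongrightarrow> indicator {x<..<y} t" for t
  proof (cases "p t = 0")
    case True
    then show ?thesis using p_out[of t] by (simp add: \<psi>_def q_def)
  next
    case False
    then have c: "q t > 0" by (simp add: q_def)
    have "filterlim (\<lambda>n. 1 + real n * q t) at_top sequentially"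
      using c by (intro filterlim_tendsto_add_at_top[OF tendsto_const]
          filterlim_at_top_mult_tendsto_pos[OF tendsto_const c] filterlim_real_sequentially)
    then have "(\<lambda>n. 1 - 1 / (1 + real n * q t)) \<longlonglongrightarrow> 1 - 0"
      by (intro tendsto_diff tendsto_const tendsto_divide_0[OF tendsto_const]
          filterlim_at_top_imp_at_infinity)
    moreover have "\<psi> n t = 1 - 1 / (1 + real n * q t)" for n
      using pos[of n t] by (simp add: \<psi>_def field_simps)
    ultimately show ?thesis
      using False p_out[of t] by auto
  qed
  ultimately show ?thesis
    by (rule that)
qed

section \<open>Functions determined by their integrals against test functions\<close>

lemma L1_mult_continuous:
  assumes f: "f \<in> L1 {a<..<b}" and \<psi>: "continuous_on UNIV \<psi>"
  shows "(\<lambda>t. f t * \<psi> t) \<in> L1 {a<..<b}"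
proof -
  have "(\<lambda>t. \<psi> t * f t) absolutely_integrable_on {a..b}"
  proof (rule absolutely_integrable_bounded_measurable_product_real)
    have "continuous_on {a..b} \<psi>"
      using \<psi> continuous_on_subset by blast
    then show "\<psi> \<in> borel_measurable (lebesgue_on {a..b})" "bounded (\<psi> ` {a..b})"
      by (auto intro: continuous_imp_measurable_on_sets_lebesgue compact_imp_bounded
          compact_continuous_image)
  qed (use f in \<open>auto simp: L1_iff\<close>)
  then show ?thesis
    by (simp add: L1_iff mult.commute)
qed

text \<open>The bumps tend boundedly to the indicator of \<open>{x<..<y}\<close>. Dominated
  convergence with majorant \<open>\<bar>f\<bar>\<close> gives integral 0 over every subinterval,
  and differentiation of integrals concludes.\<close>

lemma fundamental_lemma:
  assumes f: "f \<in> L1 {a<..<b}"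
    and 0: "\<And>\<psi>. \<psi> \<in> C1c {a<..<b} \<Longrightarrow> (\<integral>t. f t * \<psi> t \<partial>lebesgue_on {a<..<b}) = 0"
  shows "AE t in lebesgue_on {a<..<b}. f t = 0"
proof (rule AE_eq_0_if_integrals_eq_0[OF f])
  fix x y assume xy: "a < x" "x < y" "y < b"
  obtain \<psi> :: "nat \<Rightarrow> real \<Rightarrow> real" where \<psi>: "\<And>n. \<psi> n \<in> C1c {a<..<b}"
    "\<And>n t. \<bar>\<psi> n t\<bar> \<le> 1" "\<And>t. (\<lambda>n. \<psi> n t) \<longlonglongrightarrow> indicator {x<..<y} t"
    using C1c_bumps[OF xy] by metis
  have meas: "(\<lambda>t. f t * \<psi> n t) \<in> borel_measurable (lebesgue_on {a<..<b})" for n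
    using L1_mult_continuous[OF f C1cD(3)[OF \<psi>(1)]] by (auto simp: L1_def)
  have lim: "(\<lambda>n. f t * \<psi> n t) \<longlonglongrightarrow> f t * indicator {x<..<y} t" for t
    by (intro tendsto_intros \<psi>(3))
  have meas': "(\<lambda>t. f t * indicator {x<..<y} t) \<in> borel_measurable (lebesgue_on {a<..<b})"
    by (rule borel_measurable_LIMSEQ_real[OF lim meas])
  have "(\<lambda>n. \<integral>t. f t * \<psi> n t \<partial>lebesgue_on {a<..<b})
      \<longlonglongrightarrow> (\<integral>t. f t * indicator {x<..<y} t \<partial>lebesgue_on {a<..<b})"
  proof (rule integral_dominated_convergence[where w="\<lambda>t. \<bar>f t\<bar>", OF meas' meas])
    show "integrable (lebesgue_on {a<..<b}) (\<lambda>t. \<bar>f t\<bar>)"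
      using f by (auto simp: L1_def)
    show "AE t in lebesgue_on {a<..<b}. norm (f t * \<psi> n t) \<le> \<bar>f t\<bar>" for n
      using \<psi>(2)[of n] by (intro always_eventually allI) (simp add: abs_mult mult_left_le)
  qed (use lim in auto)
  then have "(\<integral>t. f t * indicator {x<..<y} t \<partial>lebesgue_on {a<..<b}) = 0"
    by (simp add: 0[OF \<psi>(1)] LIMSEQ_const_iff)
  moreover have "(\<integral>t. f t * indicator {x<..<y} t \<partial>lebesgue_on {a<..<b})
      = (\<integral>t. (if t \<in> {x<..<y} then f t else 0) \<partial>lebesgue_on {a<..<b})"
    by (intro Bochner_Integration.integral_cong) auto
  also have "\<dots> = (\<integral>t. f t \<partial>lebesgue_on {x<..<y})"
    using xy by (subst integral_restrict) auto
  also have "\<dots> = integral {x..y} f"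
    using f xy by (intro integral_L1)
     (auto simp: L1_iff intro: absolutely_integrable_on_subinterval)
  finally show "integral {x..y} f = 0" by simp
qed

section \<open>Primitives and integration by parts\<close>

lemma primitive_continuous:
  assumes "g \<in> L1 {a<..<b}"
  shows "continuous_on {a..b} (\<lambda>t. integral {a..t} g)"
  using assms by (intro indefinite_integral_continuous_1 L1_integrable_subinterval) auto

lemma L1_continuous: "continuous_on {a..b} f \<Longrightarrow> f \<in> L1 {a<..<b}"
  by (simp add: L1_iff absolutely_integrable_continuous_real)

text \<open>Fubini on the region \<open>r < t\<close>: integrating \<open>deriv \<psi>\<close> over
  \<open>t > r\<close> first leaves \<open>- \<psi> r\<close>, because \<open>\<psi>\<close>
  vanishes at the right end.\<close>

lemma primitive_by_parts:
  assumes g: "g \<in> L1 {a<..<b}" and \<psi>: "\<psi> \<in> C1c {a<..<b}"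
  shows "(\<integral>t. integral {a..t} g * deriv \<psi> t \<partial>lebesgue_on {a<..<b})
    = - (\<integral>t. g t * \<psi> t \<partial>lebesgue_on {a<..<b})"
proof -
  note d\<psi> = C1cD[OF \<psi>]
  have c\<psi>: "deriv \<psi> \<in> borel_measurable borel" "\<psi> \<in> borel_measurable borel"
    using d\<psi>(2,3) by (auto intro: borel_measurable_continuous_onI)
  have ig: "integrable lebesgue (\<lambda>t. indicator {a<..<b} t * g t)"
    using g by (simp add: L1_def integrable_restrict_space)
  \<comment> \<open>Fubini is applied to Borel functions on the product of \<open>lborel\<close>
    with itself, so the truncated \<open>g\<close> is replaced by a Borel function equal to it
    almost everywhere.\<close>
  then obtain h where h[measurable]: "h \<in> borel_measurable lborel"
    and gh: "AE t in lborel. indicator {a<..<b} t * g t = h t"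
    using completion_ex_borel_measurable_real[of "\<lambda>t. indicator {a<..<b} t * g t" lborel] by auto
  have gh': "AE t in lebesgue. indicator {a<..<b} t * g t = h t"
    using gh by (rule AE_completion)
  have hleb: "h \<in> borel_measurable lebesgue"
    using h measurable_completion by blast
  have "integrable lebesgue h"
    using ig hleb gh' by (rule integrable_cong_AE_imp)
  then have ih: "integrable lborel h"
    using h by (simp add: integrable_completion)
  have i\<psi>: "integrable lborel (deriv \<psi>)"
  proof -
    have "integrable lborel (\<lambda>t. indicator {a..b} t *\<^sub>R deriv \<psi> t)"
      using d\<psi>(2) continuous_on_subset by (intro borel_integrable_compact) auto
    moreover have "(\<lambda>t. indicator {a..b} t *\<^sub>R deriv \<psi> t) = deriv \<psi>"
    proof
      show "indicator {a..b} t *\<^sub>R deriv \<psi> t = deriv \<psi> t" for t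
        using d\<psi>(5)[of t] by (cases "t \<in> {a<..<b}") auto
    qed
    ultimately show ?thesis by simp
  qed
  \<comment> \<open>No lower limit \<open>a\<close> is imposed on \<open>r\<close>, because
    \<open>h\<close> vanishes almost everywhere outside the interval.\<close>
  define F where "F t r = indicator {..<t} r * h r * deriv \<psi> t" for t r
  have [measurable]: "deriv \<psi> \<in> borel_measurable lborel" "\<psi> \<in> borel_measurable lborel"
    using c\<psi> by auto
  have mF: "case_prod F \<in> borel_measurable (lborel \<Otimes>\<^sub>M lborel)"
  proof -
    have "case_prod F = (\<lambda>x. (if snd x < fst x then 1 else 0) * h (snd x) * deriv \<psi> (fst x))"
      by (auto simp: fun_eq_iff indicator_def F_def)
    then show ?thesis by simp
  qed
  have ih': "integrable lborel (\<lambda>r. indicator {..<t} r * h r)" for t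
    using integrable_mult_indicator[of "{..<t}" lborel h] ih by simp
  have iF: "integrable (lborel \<Otimes>\<^sub>M lborel) (case_prod F)"
  proof (rule lborel_pair.Fubini_integrable[OF mF])
    have m: "(\<lambda>t. \<integral>r. norm (case_prod F (t, r)) \<partial>lborel) \<in> borel_measurable lborel"
      by (rule lborel.borel_measurable_lebesgue_integral) (use mF in measurable)
    show "integrable lborel (\<lambda>t. \<integral>r. norm (case_prod F (t, r)) \<partial>lborel)"
    proof (rule Bochner_Integration.integrable_bound[OF _ m])
      show "integrable lborel (\<lambda>t. (\<integral>r. \<bar>h r\<bar> \<partial>lborel) * deriv \<psi> t)"
        using i\<psi> by simp
      have "norm (\<integral>r. norm (case_prod F (t, r)) \<partial>lborel) \<le> norm ((\<integral>r. \<bar>h r\<bar> \<partial>lborel) * deriv \<psi> t)" for t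
      proof -
        have "(\<integral>r. norm (case_prod F (t, r)) \<partial>lborel) \<le> (\<integral>r. \<bar>h r\<bar> * \<bar>deriv \<psi> t\<bar> \<partial>lborel)"
          using ih by (intro integral_mono') (auto simp: F_def abs_mult indicator_def)
        then show ?thesis
          by (simp add: abs_mult)
      qed
      then show "AE t in lborel. norm (\<integral>r. norm (case_prod F (t, r)) \<partial>lborel)
          \<le> norm ((\<integral>r. \<bar>h r\<bar> \<partial>lborel) * deriv \<psi> t)"
        by simp
    qed
    show "AE t in lborel. integrable lborel (\<lambda>r. case_prod F (t, r))"
      using ih' by (simp add: F_def)
  qed
  have prim: "integral {a..t} g = (\<integral>r. indicator {..<t} r * h r \<partial>lborel)" if t: "t \<in> {a<..<b}" for t
  proof -
    have "g \<in> L1 {a<..<t}"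
      using g t unfolding L1_iff by (auto intro: absolutely_integrable_on_subinterval)
    then have "integral {a..t} g = (\<integral>r. indicator {a<..<t} r * g r \<partial>lebesgue)"
      by (simp add: integral_L1[symmetric] integral_restrict_space)
    also have "\<dots> = (\<integral>r. indicator {..<t} r * h r \<partial>lebesgue)"
    proof (rule integral_cong_AE)
      show "(\<lambda>r. indicator {a<..<t} r * g r) \<in> borel_measurable lebesgue"
        using \<open>g \<in> L1 {a<..<t}\<close> by (auto simp: L1_def integrable_restrict_space)
      show "AE r in lebesgue. indicator {a<..<t} r * g r = indicator {..<t} r * h r"
        using gh' by eventually_elim (use t in \<open>auto simp: indicator_def split: if_splits\<close>)
    qed (rule measurable_completion, measurable)
    also have "\<dots> = (\<integral>r. indicator {..<t} r * h r \<partial>lborel)"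
      by (rule integral_completion) measurable
    finally show ?thesis .
  qed
  have "(\<integral>t. integral {a..t} g * deriv \<psi> t \<partial>lebesgue_on {a<..<b})
      = (\<integral>t. indicator {a<..<b} t * (integral {a..t} g * deriv \<psi> t) \<partial>lebesgue)"
    by (simp add: integral_restrict_space)
  also have "\<dots> = (\<integral>t. (\<integral>r. F t r \<partial>lborel) \<partial>lebesgue)"
  proof (rule Bochner_Integration.integral_cong[OF refl])
    show "indicator {a<..<b} t * (integral {a..t} g * deriv \<psi> t) = (\<integral>r. F t r \<partial>lborel)" for t
      using prim[of t] d\<psi>(5)[of t] by (cases "t \<in> {a<..<b}") (simp_all add: F_def)
  qed
  also have "\<dots> = (\<integral>t. (\<integral>r. F t r \<partial>lborel) \<partial>lborel)"
    using mF by (intro integral_completion lborel.borel_measurable_lebesgue_integral)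
  also have "\<dots> = (\<integral>r. (\<integral>t. F t r \<partial>lborel) \<partial>lborel)"
    using lborel_pair.Fubini_integral[OF iF] by simp
  also have "\<dots> = (\<integral>r. - (h r * \<psi> r) \<partial>lborel)"
  proof (rule Bochner_Integration.integral_cong[OF refl])
    fix r
    \<comment> \<open>\<open>deriv \<psi>\<close> and \<open>\<psi>\<close> vanish from
      \<open>b\<close> on, so nothing is lost beyond \<open>M\<close>; the maximum with
      \<open>r\<close> keeps \<open>{r..M}\<close> nonempty when \<open>r\<close> lies to the right
      of \<open>b\<close>.\<close>
    define M where "M = max r b"
    have "(\<integral>t. F t r \<partial>lborel) = (\<integral>t. h r * (deriv \<psi> t * indicator {r..M} t) \<partial>lborel)"
    proof (rule integral_cong_AE)
      \<comment> \<open>The point \<open>t = r\<close> is excluded: \<open>F\<close> uses the strict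
        inequality, the closed interval the weak one.\<close>
      show "AE t in lborel. F t r = h r * (deriv \<psi> t * indicator {r..M} t)"
        using AE_lborel_singleton[of r]
      proof eventually_elim
        fix t assume "t \<noteq> r"
        then show "F t r = h r * (deriv \<psi> t * indicator {r..M} t)"
          using d\<psi>(5)[of t] by (cases "t \<in> {a<..<b}") (auto simp: F_def M_def indicator_def)
      qed
      show "(\<lambda>t. F t r) \<in> borel_measurable lborel"
        using measurable_Pair1[OF mF, of r] by simp
    qed measurable
    also have "\<dots> = h r * (\<integral>t. deriv \<psi> t * indicator {r..M} t \<partial>lborel)"
      by (rule integral_mult_right_zero)
    also have "(\<integral>t. deriv \<psi> t * indicator {r..M} t \<partial>lborel) = \<psi> M - \<psi> r"
      using d\<psi>(1,2) by (intro integral_FTC_Icc_real) (auto simp: M_def continuous_on_eq_continuous_at)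
    also have "\<psi> M = 0"
      by (rule d\<psi>(4)) (simp add: M_def)
    finally show "(\<integral>t. F t r \<partial>lborel) = - (h r * \<psi> r)"
      by simp
  qed
  also have "\<dots> = (\<integral>r. - (h r * \<psi> r) \<partial>lebesgue)"
    by (rule integral_completion[symmetric]) measurable
  also have "\<dots> = - (\<integral>r. h r * \<psi> r \<partial>lebesgue)"
    by simp
  also have "(\<integral>r. h r * \<psi> r \<partial>lebesgue) = (\<integral>r. indicator {a<..<b} r * (g r * \<psi> r) \<partial>lebesgue)"
  proof (rule integral_cong_AE)
    show "(\<lambda>r. h r * \<psi> r) \<in> borel_measurable lebesgue"
      by (rule measurable_completion) measurable
    show "(\<lambda>r. indicator {a<..<b} r * (g r * \<psi> r)) \<in> borel_measurable lebesgue"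
      using L1_mult_continuous[OF g d\<psi>(3)] by (auto simp: L1_def integrable_restrict_space)
    show "AE r in lebesgue. h r * \<psi> r = indicator {a<..<b} r * (g r * \<psi> r)"
      using gh' by eventually_elim (metis mult.assoc)
  qed
  also have "\<dots> = (\<integral>t. g t * \<psi> t \<partial>lebesgue_on {a<..<b})"
    by (simp add: integral_restrict_space)
  finally show ?thesis .
qed

text \<open>A nonempty open interval is not a null set. This extracts witnesses from
  almost-everywhere statements.\<close>

lemma AE_lebesgue_Ioo_ex:
  assumes "AE t in lebesgue. P t" and "x < (y::real)"
  obtains t where "x < t" "t < y" "P t"
proof (rule ccontr)
  assume "\<not> thesis"
  then have "{x<..<y} \<subseteq> {t. \<not> P t}"
    using that by auto
  moreover obtain N where "negligible N" "{t. \<not> P t} \<subseteq> N"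
    using assms(1) unfolding eventually_ae_filter_negligible by blast
  ultimately have "negligible {x<..<y}"
    using negligible_subset by blast
  then have "emeasure lebesgue {x<..<y} = 0"
    by (simp add: negligible_iff_emeasure0)
  with \<open>x < y\<close> show False by simp
qed

section \<open>Weak derivatives and primitives\<close>

lemma integral_deriv_C1c:
  assumes "\<psi> \<in> C1c {a<..<b}" and "x \<le> y"
  shows "integral {x..y} (deriv \<psi>) = \<psi> y - \<psi> x"
  using C1cD(1)[OF assms(1)] assms(2)
  by (intro integral_unique fundamental_theorem_of_calculus)
    (auto simp: has_real_derivative_iff_has_vector_derivative[symmetric] intro: DERIV_subset)

lemma L1_add: "f \<in> L1 I \<Longrightarrow> g \<in> L1 I \<Longrightarrow> (\<lambda>t. f t + g t) \<in> L1 I"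
  and L1_diff: "f \<in> L1 I \<Longrightarrow> g \<in> L1 I \<Longrightarrow> (\<lambda>t. f t - g t) \<in> L1 I"
  and L1_cmult: "f \<in> L1 I \<Longrightarrow> (\<lambda>t. c * f t) \<in> L1 I"
  by (auto simp: L1_def)

lemma C1c_L1:
  assumes "\<psi> \<in> C1c {a<..<b}"
  shows "deriv \<psi> \<in> L1 {a<..<b}" "\<psi> \<in> L1 {a<..<b}"
  using C1cD(2,3)[OF assms] by (auto intro!: L1_continuous intro: continuous_on_subset)

lemma has_weak_deriv_primitive:
  assumes g: "g \<in> L1 {a<..<b}"
  shows "has_weak_deriv {a<..<b} (\<lambda>t. integral {a..t} g) g"
  using g primitive_by_parts[OF g] by (simp add: has_weak_deriv_def)

text \<open>A test function minus a suitable multiple of a fixed one with integral 1 is a derivative of a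
  test function.\<close>

lemma du_Bois_Reymond:
  assumes f: "f \<in> L1 {a<..<b}" and ab: "a < b"
    and 0: "\<And>\<psi>. \<psi> \<in> C1c {a<..<b} \<Longrightarrow> (\<integral>t. f t * deriv \<psi> t \<partial>lebesgue_on {a<..<b}) = 0"
  obtains c where "AE t in lebesgue_on {a<..<b}. f t = c"
proof -
  \<comment> \<open>If all test functions had integral 0, the fundamental lemma for the constant 1
    would yield \<open>1 = 0\<close> almost everywhere.\<close>
  have "\<exists>\<rho>\<in>C1c {a<..<b}. integral {a..b} \<rho> \<noteq> 0"
  proof (rule ccontr)
    assume z: "\<not> ?thesis"
    have "AE t in lebesgue_on {a<..<b}. (1::real) = 0"
      by (rule fundamental_lemma) (use z in \<open>auto simp: L1_continuous integral_L1 C1c_L1\<close>)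
    then show False
      unfolding AE_on_Ioo_iff using ab by (rule AE_lebesgue_Ioo_ex) auto
  qed
  then obtain \<rho> where \<rho>: "\<rho> \<in> C1c {a<..<b}" "integral {a..b} \<rho> \<noteq> 0"
    by blast
  \<comment> \<open>Testing \<open>f = c\<close> against \<open>\<rho>\<close> leaves only this
    value of the constant.\<close>
  define c where "c = integral {a..b} (\<lambda>t. f t * \<rho> t) / integral {a..b} \<rho>"
  have fc: "(\<lambda>t. f t - c) \<in> L1 {a<..<b}"
    by (intro L1_diff f L1_continuous) auto
  have "AE t in lebesgue_on {a<..<b}. f t - c = 0"
  proof (rule fundamental_lemma[OF fc])
    fix \<phi> assume \<phi>: "\<phi> \<in> C1c {a<..<b}"
    \<comment> \<open>This multiple gives \<open>\<eta>\<close> integral 0, so its primitive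
      \<open>\<psi>\<close> returns to 0 at \<open>b\<close> and has compact support.\<close>
    define k where "k = integral {a..b} \<phi> / integral {a..b} \<rho>"
    define \<eta> where "\<eta> t = \<phi> t - k * \<rho> t" for t
    define \<psi> where "\<psi> t = integral {a..t} \<eta>" for t
    obtain c1 d1 where 1: "a < c1" "c1 \<le> d1" "d1 < b" "\<And>t. t \<notin> {c1..d1} \<Longrightarrow> \<phi> t = 0"
      using C1c_support[OF \<phi> ab] by metis
    obtain c2 d2 where 2: "a < c2" "c2 \<le> d2" "d2 < b" "\<And>t. t \<notin> {c2..d2} \<Longrightarrow> \<rho> t = 0"
      using C1c_support[OF \<rho>(1) ab] by metis
    define C D where "C = min c1 c2" and "D = max d1 d2"
    have CD: "a < C" "D < b" "C \<le> D"
      using 1 2 by (auto simp: C_def D_def)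
    have \<eta>0: "\<eta> t = 0" if "t \<notin> {C..D}" for t
      using that 1(4)[of t] 2(4)[of t] by (auto simp: \<eta>_def C_def D_def min_le_iff_disj le_max_iff_disj)
    have c\<eta>: "continuous_on S \<eta>" for S
      unfolding \<eta>_def by (intro continuous_intros continuous_on_subset[OF C1cD(3)[OF \<phi>]]
          continuous_on_subset[OF C1cD(3)[OF \<rho>(1)]]) auto
    have i\<eta>: "\<eta> integrable_on {x..y}" for x y
      by (intro integrable_continuous_real c\<eta>)
    have L\<phi>: "\<phi> integrable_on {a..b}" "\<rho> integrable_on {a..b}"
      using C1c_L1(2)[OF \<phi>] C1c_L1(2)[OF \<rho>(1)] L1_integrable_subinterval by blast+
    have I\<eta>: "integral {a..b} \<eta> = 0"
    proof -
      have "integral {a..b} \<eta> = integral {a..b} \<phi> - integral {a..b} (\<lambda>t. k * \<rho> t)"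
        unfolding \<eta>_def using L\<phi>
        by (intro Henstock_Kurzweil_Integration.integral_diff integrable_on_mult_right)
      then show ?thesis
        using \<rho>(2) by (simp add: k_def)
    qed
    \<comment> \<open>Left of \<open>C\<close> the integrand is 0 (left of \<open>a\<close> the
      interval of integration is empty). Right of \<open>D\<close> the remaining integral up to
      \<open>b\<close> is 0, and so is the part beyond \<open>b\<close>; a test function must be
      controlled on the whole line.\<close>
    have \<psi>0: "\<psi> t = 0" if "t \<notin> {C..D}" for t
    proof (cases "t < C")
      case True
      have "\<psi> t = integral {a..t} (\<lambda>_. 0)"
        unfolding \<psi>_def using True by (intro integral_cong \<eta>0) auto
      then show ?thesis by simp
    next
      case False
      with that have t: "t > D" by auto
      show ?thesis
      proof (cases "t \<le> b")
        case True
        have "integral {a..t} \<eta> + integral {t..b} \<eta> = integral {a..b} \<eta>"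
          using t CD True by (intro Henstock_Kurzweil_Integration.integral_combine i\<eta>) auto
        moreover have "integral {t..b} \<eta> = integral {t..b} (\<lambda>_. 0)"
          using t by (intro integral_cong \<eta>0) auto
        ultimately show ?thesis
          using I\<eta> by (simp add: \<psi>_def)
      next
        case False
        have "integral {a..b} \<eta> + integral {b..t} \<eta> = integral {a..t} \<eta>"
          using False ab by (intro Henstock_Kurzweil_Integration.integral_combine i\<eta>) auto
        moreover have "integral {b..t} \<eta> = integral {b..t} (\<lambda>_. 0)"
          using CD by (intro integral_cong \<eta>0) auto
        ultimately show ?thesis
          using I\<eta> by (simp add: \<psi>_def)
      qed
    qed
    have d\<psi>: "(\<psi> has_real_derivative \<eta> t) (at t)" for t
    proof (cases "t < C")
      case True
      have "(\<psi> has_real_derivative 0) (at t)"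
        by (rule has_field_derivative_transform_within_open[where f="\<lambda>_. 0" and S="{..<C}"])
          (use True in \<open>auto simp: \<psi>0\<close>)
      then show ?thesis
        using \<eta>0[of t] True by simp
    next
      case False
      have "(\<psi> has_real_derivative \<eta> t) (at t within {a..t+1})"
        using integral_has_vector_derivative[OF c\<eta>, of t a "t+1"] False CD
        by (simp add: \<psi>_def[abs_def] has_real_derivative_iff_has_vector_derivative)
      moreover have "at t within {a..t+1} = at t"
        using False CD by (intro at_within_interior) auto
      ultimately show ?thesis by simp
    qed
    have \<psi>: "\<psi> \<in> C1c {a<..<b}"
      by (rule C1cI[OF d\<psi> c\<eta> \<psi>0]) (use CD in auto)
    have "deriv \<psi> = \<eta>"
      using d\<psi> by (auto intro: DERIV_imp_deriv)
    have i1: "(\<lambda>t. f t * \<phi> t) \<in> L1 {a<..<b}" and i2: "(\<lambda>t. f t * \<rho> t) \<in> L1 {a<..<b}"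
      by (intro L1_mult_continuous f C1cD(3)[OF \<phi>] C1cD(3)[OF \<rho>(1)])+
    \<comment> \<open>The hypothesis is used for \<open>\<psi>\<close>, whose derivative is
      \<open>\<eta>\<close>; the \<open>\<rho>\<close> term then turns into \<open>c\<close> times
      the integral of \<open>\<phi>\<close> by the choice of \<open>k\<close> and
      \<open>c\<close>.\<close>
    have "0 = (\<integral>t. f t * \<phi> t - k * (f t * \<rho> t) \<partial>lebesgue_on {a<..<b})"
      using 0[OF \<psi>] by (simp add: \<open>deriv \<psi> = \<eta>\<close> \<eta>_def algebra_simps)
    also have "\<dots> = (\<integral>t. f t * \<phi> t \<partial>lebesgue_on {a<..<b}) - k * (\<integral>t. f t * \<rho> t \<partial>lebesgue_on {a<..<b})"
      using i1 i2 by (simp add: L1_def)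
    also have "k * (\<integral>t. f t * \<rho> t \<partial>lebesgue_on {a<..<b}) = c * (\<integral>t. \<phi> t \<partial>lebesgue_on {a<..<b})"
      by (simp add: integral_L1[OF i2] integral_L1[OF C1c_L1(2)[OF \<phi>]] k_def c_def)
    also have "(\<integral>t. f t * \<phi> t \<partial>lebesgue_on {a<..<b}) - c * (\<integral>t. \<phi> t \<partial>lebesgue_on {a<..<b})
        = (\<integral>t. (f t - c) * \<phi> t \<partial>lebesgue_on {a<..<b})"
      using i1 C1c_L1(2)[OF \<phi>] by (simp add: L1_def left_diff_distrib)
    finally show "(\<integral>t. (f t - c) * \<phi> t \<partial>lebesgue_on {a<..<b}) = 0" by simp
  qed
  then show ?thesis
    by (intro that[of c]) simp
qed

text \<open>Subtracting the primitive of \<open>g\<close> leaves a function with weak derivative 0,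
  which is constant by \<open>du_Bois_Reymond\<close>.\<close>

lemma has_weak_deriv_imp_primitive:
  assumes w: "w \<in> L1 {a<..<b}" and wg: "has_weak_deriv {a<..<b} w g" and ab: "a < b"
  obtains c where "AE t in lebesgue_on {a<..<b}. w t = c + integral {a..t} g"
proof -
  have g: "g \<in> L1 {a<..<b}"
    using wg by (simp add: has_weak_deriv_def)
  have V: "(\<lambda>t. integral {a..t} g) \<in> L1 {a<..<b}"
    by (intro L1_continuous primitive_continuous g)
  have "(\<integral>t. (w t - integral {a..t} g) * deriv \<psi> t \<partial>lebesgue_on {a<..<b}) = 0"
    if \<psi>: "\<psi> \<in> C1c {a<..<b}" for \<psi>
    using L1_mult_continuous[OF w C1cD(2)[OF \<psi>]] L1_mult_continuous[OF V C1cD(2)[OF \<psi>]]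
      primitive_by_parts[OF g \<psi>] wg \<psi>
    by (simp add: L1_def left_diff_distrib has_weak_deriv_def)
  from du_Bois_Reymond[OF L1_diff[OF w V] ab this] obtain c
    where "AE t in lebesgue_on {a<..<b}. w t - integral {a..t} g = c" by metis
  then have "AE t in lebesgue_on {a<..<b}. w t = c + integral {a..t} g"
    by eventually_elim simp
  then show ?thesis by (rule that)
qed

lemma has_weak_deriv_weak_deriv: "has_weak_deriv I w g \<Longrightarrow> has_weak_deriv I w (weak_deriv I w)"
  unfolding weak_deriv_def by (rule someI[of "has_weak_deriv I w"])

text \<open>Makes integrals of expressions in \<open>weak_deriv\<close> independent of the choice
  behind it.\<close>

lemma has_weak_deriv_unique:
  assumes "has_weak_deriv {a<..<b} w g" "has_weak_deriv {a<..<b} w h"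
  shows "AE t in lebesgue_on {a<..<b}. g t = h t"
proof -
  have gh: "g \<in> L1 {a<..<b}" "h \<in> L1 {a<..<b}"
    using assms by (auto simp: has_weak_deriv_def)
  have "AE t in lebesgue_on {a<..<b}. g t - h t = 0"
  proof (rule fundamental_lemma[OF L1_diff[OF gh]])
    fix \<psi> assume \<psi>: "\<psi> \<in> C1c {a<..<b}"
    then show "(\<integral>t. (g t - h t) * \<psi> t \<partial>lebesgue_on {a<..<b}) = 0"
      using assms L1_mult_continuous[OF gh(1) C1cD(3)[OF \<psi>]] L1_mult_continuous[OF gh(2) C1cD(3)[OF \<psi>]]
      by (simp add: L1_def left_diff_distrib has_weak_deriv_def)
  qed
  then show ?thesis by simp
qed

section \<open>One-sided traces\<close>

lemma trace_rightI:
  assumes "a < b" and f: "continuous_on {a..b} f" and ae: "AE t in lebesgue_on {a<..<b}. w t = f t"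
  shows "trace_right w a (f a)"
  unfolding trace_right_def
proof (intro allI impI)
  fix e :: real assume "e > 0"
  then obtain d where d: "d > 0" "\<And>t. t \<in> {a..b} \<Longrightarrow> dist t a < d \<Longrightarrow> dist (f t) (f a) < e"
    using f \<open>a < b\<close> unfolding continuous_on_iff by (metis atLeastAtMost_iff less_imp_le order_refl)
  have "AE t in lebesgue. a < t \<and> t < a + min d (b - a) \<longrightarrow> \<bar>w t - f a\<bar> < e"
    using ae[unfolded AE_on_Ioo_iff]
    by eventually_elim (use d in \<open>force simp: dist_real_def\<close>)
  then show "\<exists>d>0. AE t in lebesgue. a < t \<and> t < a + d \<longrightarrow> \<bar>w t - f a\<bar> < e"
    using d \<open>a < b\<close> by (intro exI[of _ "min d (b - a)"]) auto
qed

lemma trace_leftI: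
  assumes "a < b" and f: "continuous_on {a..b} f" and ae: "AE t in lebesgue_on {a<..<b}. w t = f t"
  shows "trace_left w b (f b)"
  unfolding trace_left_def
proof (intro allI impI)
  fix e :: real assume "e > 0"
  then obtain d where d: "d > 0" "\<And>t. t \<in> {a..b} \<Longrightarrow> dist t b < d \<Longrightarrow> dist (f t) (f b) < e"
    using f \<open>a < b\<close> unfolding continuous_on_iff by (metis atLeastAtMost_iff less_imp_le order_refl)
  have "AE t in lebesgue. b - min d (b - a) < t \<and> t < b \<longrightarrow> \<bar>w t - f b\<bar> < e"
    using ae[unfolded AE_on_Ioo_iff]
    by eventually_elim (use d in \<open>force simp: dist_real_def\<close>)
  then show "\<exists>d>0. AE t in lebesgue. b - d < t \<and> t < b \<longrightarrow> \<bar>w t - f b\<bar> < e"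
    using d \<open>a < b\<close> by (intro exI[of _ "min d (b - a)"]) auto
qed

text \<open>Near \<open>a\<close> both essential bounds hold at a common point, and the triangle
  inequality there is contradictory if the radius is half the distance of the two
  candidates.\<close>

lemma trace_right_unique:
  assumes "trace_right w a c" "trace_right w a d"
  shows "c = d"
proof (rule ccontr)
  assume "c \<noteq> d"
  then have e: "\<bar>c - d\<bar> / 2 > 0" by simp
  obtain r where r: "r > 0" "AE t in lebesgue. a < t \<and> t < a + r \<longrightarrow> \<bar>w t - c\<bar> < \<bar>c - d\<bar> / 2"
    using assms(1)[unfolded trace_right_def, rule_format, OF e] by blast
  obtain q where q: "q > 0" "AE t in lebesgue. a < t \<and> t < a + q \<longrightarrow> \<bar>w t - d\<bar> < \<bar>c - d\<bar> / 2"
    using assms(2)[unfolded trace_right_def, rule_format, OF e] by blast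
  have "AE t in lebesgue. a < t \<and> t < a + min r q \<longrightarrow> \<bar>w t - c\<bar> < \<bar>c - d\<bar> / 2 \<and> \<bar>w t - d\<bar> < \<bar>c - d\<bar> / 2"
    using r(2) q(2) by eventually_elim auto
  then obtain t where "a < t" "t < a + min r q"
      "a < t \<and> t < a + min r q \<longrightarrow> \<bar>w t - c\<bar> < \<bar>c - d\<bar> / 2 \<and> \<bar>w t - d\<bar> < \<bar>c - d\<bar> / 2"
    by (rule AE_lebesgue_Ioo_ex[of _ a "a + min r q"]) (use r(1) q(1) in auto)
  then have "\<bar>w t - c\<bar> < \<bar>c - d\<bar> / 2" "\<bar>w t - d\<bar> < \<bar>c - d\<bar> / 2"
    by blast+
  then show False
    using abs_triangle_ineq4[of "w t - d" "w t - c"] by simp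
qed

lemma trace_left_unique:
  assumes "trace_left w b c" "trace_left w b d"
  shows "c = d"
proof (rule ccontr)
  assume "c \<noteq> d"
  then have e: "\<bar>c - d\<bar> / 2 > 0" by simp
  obtain r where r: "r > 0" "AE t in lebesgue. b - r < t \<and> t < b \<longrightarrow> \<bar>w t - c\<bar> < \<bar>c - d\<bar> / 2"
    using assms(1)[unfolded trace_left_def, rule_format, OF e] by blast
  obtain q where q: "q > 0" "AE t in lebesgue. b - q < t \<and> t < b \<longrightarrow> \<bar>w t - d\<bar> < \<bar>c - d\<bar> / 2"
    using assms(2)[unfolded trace_left_def, rule_format, OF e] by blast
  have "AE t in lebesgue. b - min r q < t \<and> t < b \<longrightarrow> \<bar>w t - c\<bar> < \<bar>c - d\<bar> / 2 \<and> \<bar>w t - d\<bar> < \<bar>c - d\<bar> / 2"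
    using r(2) q(2) by eventually_elim auto
  moreover have "b - min r q < b"
    using r(1) q(1) by simp
  ultimately obtain t where "b - min r q < t" "t < b"
      "b - min r q < t \<and> t < b \<longrightarrow> \<bar>w t - c\<bar> < \<bar>c - d\<bar> / 2 \<and> \<bar>w t - d\<bar> < \<bar>c - d\<bar> / 2"
    by (rule AE_lebesgue_Ioo_ex)
  then have "\<bar>w t - c\<bar> < \<bar>c - d\<bar> / 2" "\<bar>w t - d\<bar> < \<bar>c - d\<bar> / 2"
    by blast+
  then show False
    using abs_triangle_ineq4[of "w t - d" "w t - c"] by simp
qed

text \<open>The traces determine the constant of integration: the continuous representative is
  \<open>c'\<close> plus the primitive, and uniqueness of traces identifies its two end
  values.\<close>

lemma W11_traces_primitive:
  assumes w: "w \<in> W11 {a<..<b}" and tr: "trace_right w a c" "trace_left w b d" and ab: "a < b"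
    and g: "g = weak_deriv {a<..<b} w"
  shows "g \<in> L1 {a<..<b}" "AE t in lebesgue_on {a<..<b}. w t = c + integral {a..t} g"
    "c + integral {a..b} g = d"
proof -
  have wg: "has_weak_deriv {a<..<b} w g" and wL: "w \<in> L1 {a<..<b}"
    using w unfolding W11_def g by (auto intro: has_weak_deriv_weak_deriv)
  then show gL: "g \<in> L1 {a<..<b}"
    by (simp add: has_weak_deriv_def)
  obtain c' where c': "AE t in lebesgue_on {a<..<b}. w t = c' + integral {a..t} g"
    using has_weak_deriv_imp_primitive[OF wL wg ab] by metis
  have ct: "continuous_on {a..b} (\<lambda>t. c' + integral {a..t} g)"
    by (intro continuous_intros primitive_continuous gL)
  have "c' = c"
    using trace_right_unique[OF trace_rightI[OF ab ct c'] tr(1)] by simp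
  then show "AE t in lebesgue_on {a<..<b}. w t = c + integral {a..t} g"
    using c' by simp
  show "c + integral {a..b} g = d"
    using trace_left_unique[OF trace_leftI[OF ab ct c'] tr(2)] \<open>c' = c\<close> by simp
qed

text \<open>Source of competitors: any integrable density produces one, with its traces and weak
  derivative known.\<close>

lemma primitive_W11:
  assumes "g \<in> L1 {a<..<b}" "a < b"
  shows "(\<lambda>t. integral {a..t} g) \<in> W11 {a<..<b}"
    "trace_right (\<lambda>t. integral {a..t} g) a 0"
    "trace_left (\<lambda>t. integral {a..t} g) b (integral {a..b} g)"
    "AE t in lebesgue_on {a<..<b}. weak_deriv {a<..<b} (\<lambda>t. integral {a..t} g) t = g t"
proof -
  note c = primitive_continuous[OF assms(1)]
  note wd = has_weak_deriv_primitive[OF assms(1)]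
  show W: "(\<lambda>t. integral {a..t} g) \<in> W11 {a<..<b}"
    using wd L1_continuous[OF c] by (auto simp: W11_def)
  show "trace_right (\<lambda>t. integral {a..t} g) a 0"
    using trace_rightI[OF assms(2) c] by simp
  show "trace_left (\<lambda>t. integral {a..t} g) b (integral {a..b} g)"
    using trace_leftI[OF assms(2) c] by simp
  have "has_weak_deriv {a<..<b} (\<lambda>t. integral {a..t} g) (weak_deriv {a<..<b} (\<lambda>t. integral {a..t} g))"
    using wd by (rule has_weak_deriv_weak_deriv)
  then show "AE t in lebesgue_on {a<..<b}. weak_deriv {a<..<b} (\<lambda>t. integral {a..t} g) t = g t"
    using wd by (rule has_weak_deriv_unique)
qed

section \<open>Calibration\<close>

lemma four_mult_le_square_add: "4 * x * y \<le> (x + y)\<^sup>2" for x y :: real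
  using zero_le_power2[of "x - y"] by (simp add: power2_eq_square algebra_simps)

text \<open>\<open>d\<close> and \<open>p * u - q * c\<close> are the components of
  \<open>(p, q)\<close> along and across the unit vector \<open>(c, u)\<close>. Hence the square of
  the latter is \<open>(N - d) * (N + d)\<close>, at most \<open>2 * N * (N - d)\<close>. The weight
  \<open>\<eta>\<close> turns this into a bound linear in the deficit \<open>N - d\<close>, which
  can be integrated.\<close>

lemma calibration_plane:
  fixes p q c u \<eta> :: real
  assumes cu: "c\<^sup>2 + u\<^sup>2 = 1" and \<eta>: "\<eta> > 0"
  defines "N \<equiv> sqrt (p\<^sup>2 + q\<^sup>2)" and "d \<equiv> p * c + q * u"
  shows "d \<le> N" "\<bar>p * u - q * c\<bar> \<le> (N - d) / \<eta> + \<eta> / 2 * N"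
proof -
  have N: "N \<ge> 0" "N\<^sup>2 = p\<^sup>2 + q\<^sup>2"
    by (auto simp: N_def)
  have "(p\<^sup>2 + q\<^sup>2) * (c\<^sup>2 + u\<^sup>2) = d\<^sup>2 + (p * u - q * c)\<^sup>2"
    by (simp add: d_def power2_eq_square algebra_simps)
  then have id: "N\<^sup>2 = d\<^sup>2 + (p * u - q * c)\<^sup>2"
    using cu N by simp
  then have "d\<^sup>2 \<le> N\<^sup>2"
    by simp
  then show dN: "d \<le> N"
    using N(1) power2_le_imp_le by blast
  have "(p * u - q * c)\<^sup>2 = (N - d) * (N + d)"
    using id by (simp add: power2_eq_square algebra_simps)
  also have "\<dots> \<le> (N - d) * (2 * N)"
    using dN by (intro mult_left_mono) auto
  also have "\<dots> = 4 * ((N - d) / \<eta>) * (\<eta> / 2 * N)"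
    using \<eta> by simp
  also have "\<dots> \<le> ((N - d) / \<eta> + \<eta> / 2 * N)\<^sup>2"
    by (rule four_mult_le_square_add)
  finally have "\<bar>p * u - q * c\<bar>\<^sup>2 \<le> ((N - d) / \<eta> + \<eta> / 2 * N)\<^sup>2"
    by simp
  then show "\<bar>p * u - q * c\<bar> \<le> (N - d) / \<eta> + \<eta> / 2 * N"
    using dN N(1) \<eta> by (intro power2_le_imp_le[of "\<bar>p * u - q * c\<bar>"]) auto
qed

text \<open>Apply the plane inequality to the vector \<open>(sqrt A x, sqrt B)\<close> and the unit vector
  \<open>(k / sqrt A, sqrt (1 - k\<^sup>2 / A))\<close>.\<close>

lemma calibration_pointwise:
  fixes A B k x \<eta> :: real
  assumes A: "A > 0" and B: "B \<ge> 0" and k: "k\<^sup>2 \<le> A"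
  defines "N \<equiv> sqrt (A * x\<^sup>2 + B)" and "e \<equiv> sqrt (B * (1 - k\<^sup>2 / A))"
    and "g \<equiv> sqrt (k\<^sup>2 * B / (A * (A - k\<^sup>2)))"
  shows "k * x + e \<le> N"
    "k \<ge> 0 \<Longrightarrow> \<eta> > 0 \<Longrightarrow> sqrt (A - k\<^sup>2) * \<bar>x - g\<bar> \<le> (N - (k * x + e)) / \<eta> + \<eta> / 2 * N"
proof -
  define c u p q where "c = k / sqrt A" and "u = sqrt (1 - k\<^sup>2 / A)" and "p = sqrt A * x" and "q = sqrt B"
  have k1: "k\<^sup>2 / A \<le> 1"
    using A k by simp
  have cu: "c\<^sup>2 + u\<^sup>2 = 1"
    using A k1 by (simp add: c_def u_def power_divide)
  have N: "N = sqrt (p\<^sup>2 + q\<^sup>2)"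
    using A B by (simp add: N_def p_def q_def power_mult_distrib)
  have d: "k * x + e = p * c + q * u"
    using A by (simp add: e_def p_def c_def q_def u_def real_sqrt_mult)
  show le: "k * x + e \<le> N"
    using calibration_plane(1)[OF cu zero_less_one, of p q] by (simp add: N d)
  show "sqrt (A - k\<^sup>2) * \<bar>x - g\<bar> \<le> (N - (k * x + e)) / \<eta> + \<eta> / 2 * N" if "k \<ge> 0" "\<eta> > 0"
  proof (cases "k\<^sup>2 = A")
    \<comment> \<open>The factor \<open>sqrt (A - k\<^sup>2)\<close> is 0, so the division by zero
      inside \<open>g\<close> does no harm; a nonnegative deficit suffices.\<close>
    case True
    have "N \<ge> 0"
      using A B by (simp add: N_def)
    then show ?thesis
      using True le that by simp
  next
    case False
    have D: "sqrt (A - k\<^sup>2) = sqrt A * u"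
      using A by (simp add: u_def real_sqrt_mult[symmetric] right_diff_distrib)
    have "A - k\<^sup>2 > 0"
      using k False by simp
    \<comment> \<open>With this identity the left side becomes the cross component
      \<open>p * u - q * c\<close>.\<close>
    then have g': "sqrt (A - k\<^sup>2) * g = q * c"
      using A B that by (simp add: g_def q_def c_def real_sqrt_divide real_sqrt_mult)
    have "sqrt (A - k\<^sup>2) * \<bar>x - g\<bar> = \<bar>sqrt (A - k\<^sup>2) * x - sqrt (A - k\<^sup>2) * g\<bar>"
      using k by (simp add: abs_mult right_diff_distrib[symmetric])
    also have "sqrt (A - k\<^sup>2) * x = p * u"
      by (simp add: D p_def)
    finally show ?thesis
      using calibration_plane(2)[OF cu \<open>\<eta> > 0\<close>, of p q] by (simp add: N d g')
  qed
qed

text \<open>Equality case of Cauchy-Schwarz: at this slope \<open>(sqrt A * g, sqrt B)\<close> is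
  parallel to the calibrating unit vector. Both sides are reduced to
  \<open>sqrt (A * B / D)\<close>.\<close>

lemma calibration_eq:
  fixes A B k :: real
  assumes A: "A > 0" and B: "B \<ge> 0" and k: "k\<^sup>2 < A" "k \<ge> 0"
  defines "g \<equiv> sqrt (k\<^sup>2 * B / (A * (A - k\<^sup>2)))"
  shows "sqrt (A * g\<^sup>2 + B) = k * g + sqrt (B * (1 - k\<^sup>2 / A))"
proof -
  define D where "D = A - k\<^sup>2"
  have D: "D > 0" and kA: "k\<^sup>2 = A - D"
    using k by (auto simp: D_def)
  have g': "g = k * sqrt B / (sqrt A * sqrt D)"
    using k by (simp add: g_def D_def real_sqrt_divide real_sqrt_mult)
  have e': "sqrt (B * (1 - k\<^sup>2 / A)) = sqrt B * sqrt D / sqrt A"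
    using A by (simp add: kA diff_divide_distrib real_sqrt_mult real_sqrt_divide)
  have "k * g + sqrt (B * (1 - k\<^sup>2 / A)) = (k\<^sup>2 * sqrt B + sqrt B * (sqrt D)\<^sup>2) / (sqrt A * sqrt D)"
    unfolding g' e' using A D by (simp add: field_simps power2_eq_square del: real_sqrt_mult_self)
  also have "(sqrt D)\<^sup>2 = D"
    using D by simp
  also have "k\<^sup>2 * sqrt B + sqrt B * D = sqrt B * A"
    by (simp add: kA algebra_simps)
  also have "sqrt B * A / (sqrt A * sqrt D) = sqrt (A * B / D)"
    using A D by (simp add: real_sqrt_divide real_sqrt_mult field_simps)
  also have "A * B / D = A * g\<^sup>2 + B"
  proof -
    have "g\<^sup>2 = k\<^sup>2 * B / (A * D)"
      using A B D by (simp add: g_def D_def)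
    then show ?thesis
      using A D by (simp add: kA field_simps)
  qed
  finally show ?thesis by simp
qed

text \<open>Isolates the features of the weights that the variational argument uses.
  \<open>A\<close> is continuous on the open interval only, since it may blow up at the end points;
  its symmetry and strict growth make \<open>m\<close> the unique minimum point.\<close>

locale profile =
  fixes a b m s :: real and A B :: "real \<Rightarrow> real"
  assumes ab: "a < m" "m < b" "a + b = 2 * m" and s_pos: "s > 0"
    and A_cont: "continuous_on {a<..<b} A" and A_sym: "\<And>t. A (2 * m - t) = A t"
    and A_strict: "\<And>x y. m \<le> x \<Longrightarrow> x < y \<Longrightarrow> y < b \<Longrightarrow> A x < A y" and A_pos: "A m > 0"
    and B_cont: "continuous_on {a..b} B" and B_sym: "\<And>t. B (2 * m - t) = B t"
    and B_pos: "\<And>t. t \<in> {a<..<b} \<Longrightarrow> B t > 0"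
begin

abbreviation "I \<equiv> {a<..<b}"

abbreviation "M \<equiv> lebesgue_on I"

lemma ab': "a < b" "m \<in> I"
  using ab by auto

lemma A_abs: "A t = A (m + \<bar>t - m\<bar>)"
  using A_sym[of t] by (cases "t \<ge> m") (auto simp: algebra_simps)

lemma A_mono:
  assumes "\<bar>t - m\<bar> \<le> \<bar>t' - m\<bar>" "t' \<in> I"
  shows "A t \<le> A t'"
proof (cases "\<bar>t - m\<bar> = \<bar>t' - m\<bar>")
  case True
  then show ?thesis by (metis A_abs order_refl)
next
  case False
  then have "A (m + \<bar>t - m\<bar>) < A (m + \<bar>t' - m\<bar>)"
    using assms ab by (intro A_strict) auto
  then show ?thesis by (metis A_abs less_imp_le)
qed

lemma A_less:
  assumes "\<bar>t - m\<bar> < \<bar>t' - m\<bar>" "t' \<in> I"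
  shows "A t < A t'"
proof -
  have "A (m + \<bar>t - m\<bar>) < A (m + \<bar>t' - m\<bar>)"
    using assms ab by (intro A_strict) auto
  then show ?thesis by (metis A_abs)
qed

lemma A_min: "t \<in> I \<Longrightarrow> A m \<le> A t"
  by (rule A_mono) auto

lemma A_pos': "t \<in> I \<Longrightarrow> A t > 0"
  using A_min[of t] A_pos by simp

lemma borel_AB [measurable]: "A \<in> borel_measurable M" "B \<in> borel_measurable M"
  using A_cont B_cont by (auto intro!: continuous_imp_measurable_on_sets_lebesgue
      intro: continuous_on_subset)

lemma finite_M: "finite_measure M"
  by (intro finite_measure_lebesgue_on) auto

text \<open>For \<open>k = k_max\<close> the denominator of \<open>slope\<close> vanishes at
  \<open>m\<close>, so pointwise facts about it are claimed away from this null point.\<close>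

lemma AE_ne_m: "AE t in M. t \<noteq> m"
  unfolding AE_on_Ioo_iff using AE_completion[OF AE_lborel_singleton[of m]] by eventually_elim simp

lemma B_bounded: obtains C where "C > 0" "\<And>t. t \<in> {a..b} \<Longrightarrow> \<bar>B t\<bar> \<le> C"
proof -
  have "bounded (B ` {a..b})"
    by (intro compact_imp_bounded compact_continuous_image B_cont) auto
  then show ?thesis
    using that unfolding bounded_pos by auto
qed

text \<open>For \<open>k \<ge> 0\<close> and \<open>k\<^sup>2 < A t\<close> this is the solution
  \<open>x\<close> of \<open>A t * x / sqrt (A t * x\<^sup>2 + B t) = k\<close>, the first integral
  of the Euler-Lagrange equation.\<close>

definition slope :: "real \<Rightarrow> real \<Rightarrow> real" where
  "slope k t = sqrt (k\<^sup>2 * B t / (A t * (A t - k\<^sup>2)))"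

text \<open>For \<open>k\<^sup>2 < A t\<close> this is the minimum over \<open>x\<close> of
  \<open>sqrt (A t * x\<^sup>2 + B t) - k * x\<close>, a convex conjugate up to sign.\<close>

definition rest :: "real \<Rightarrow> real \<Rightarrow> real" where
  "rest k t = sqrt (B t * (1 - k\<^sup>2 / A t))"

definition energy_bound :: "real \<Rightarrow> real" where
  "energy_bound k = k * s + (\<integral>t. rest k t \<partial>M)"

section \<open>The family of slopes and the choice of its parameter\<close>

abbreviation "k_max \<equiv> sqrt (A m)"

lemma k_sq:
  assumes "k \<in> {0..k_max}"
  shows "k\<^sup>2 \<le> A m"
proof -
  have "k\<^sup>2 \<le> k_max\<^sup>2"
    using assms by (intro power_mono) auto
  then show ?thesis using A_pos by simp
qed

lemma A_gt:
  assumes "k \<in> {0..k_max}" "t \<in> I" "k < k_max \<or> t \<noteq> m"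
  shows "k\<^sup>2 < A t"
proof (cases "t = m")
  case True
  then have "k\<^sup>2 < k_max\<^sup>2"
    using assms by (intro power_strict_mono) auto
  then show ?thesis using A_pos True by simp
next
  case False
  then have "A m < A t"
    using assms by (intro A_less) auto
  then show ?thesis using k_sq[OF assms(1)] by simp
qed

lemma slope_measurable [measurable]: "slope k \<in> borel_measurable M"
  unfolding slope_def by measurable

lemma rest_measurable [measurable]: "rest k \<in> borel_measurable M"
  unfolding rest_def by measurable

lemma rest_integrable:
  assumes k: "k \<in> {0..k_max}"
  shows "integrable M (rest k)"
proof -
  obtain C where C: "C > 0" "\<And>t. t \<in> {a..b} \<Longrightarrow> \<bar>B t\<bar> \<le> C"
    by (rule B_bounded) auto
  have "norm (rest k t) \<le> sqrt C" if t: "t \<in> I" for t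
  proof -
    have At: "k\<^sup>2 \<le> A t" "A t > 0"
      using k_sq[OF k] A_min[OF t] A_pos by auto
    have "0 \<le> 1 - k\<^sup>2 / A t" "1 - k\<^sup>2 / A t \<le> 1"
      using At by auto
    then have "B t * (1 - k\<^sup>2 / A t) \<le> C * 1"
      using C(1) C(2)[of t] t B_pos[OF t] by (intro mult_mono) auto
    then show ?thesis
      using B_pos[OF t] \<open>0 \<le> 1 - k\<^sup>2 / A t\<close> by (simp add: rest_def)
  qed
  then show ?thesis
    by (intro finite_measure.integrable_const_bound[OF finite_M, of _ "sqrt C"] AE_I2) auto
qed

lemma rest_nonneg: "k \<in> {0..k_max} \<Longrightarrow> t \<in> I \<Longrightarrow> rest k t \<ge> 0"
  using k_sq[of k] A_min[of t] A_pos B_pos[of t] by (simp add: rest_def)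

lemma slope_nonneg:
  assumes "k \<in> {0..k_max}" "t \<in> I"
  shows "slope k t \<ge> 0"
  using k_sq[OF assms(1)] A_min[OF assms(2)] A_pos B_pos[OF assms(2)] by (simp add: slope_def)

lemma slope_pos:
  assumes "k \<in> {0<..k_max}" "t \<in> I" "t \<noteq> m"
  shows "slope k t > 0"
  using A_gt[of k t] assms A_pos'[OF assms(2)] B_pos[OF assms(2)] by (simp add: slope_def)

text \<open>Strict monotonicity in the parameter gives its uniqueness as well as the majorants and
  monotone limits used to find it.\<close>

lemma slope_less:
  assumes "0 \<le> k" "k < k'" "k' \<le> k_max" "t \<in> I" "t \<noteq> m \<or> k' < k_max"
  shows "slope k t < slope k' t"
proof -
  have A: "k'\<^sup>2 < A t" "A t > 0" "B t > 0"
    using A_gt[of k' t] assms A_pos' B_pos by auto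
  have kk: "k\<^sup>2 < k'\<^sup>2"
    using assms by (intro power_strict_mono) auto
  have "k\<^sup>2 * B t * (A t * (A t - k'\<^sup>2)) < k'\<^sup>2 * B t * (A t * (A t - k\<^sup>2))"
  proof -
    have "k\<^sup>2 * (A t - k'\<^sup>2) < k'\<^sup>2 * (A t - k\<^sup>2)"
      using kk A by (simp add: algebra_simps)
    then have "(A t * B t) * (k\<^sup>2 * (A t - k'\<^sup>2)) < (A t * B t) * (k'\<^sup>2 * (A t - k\<^sup>2))"
      using A by (intro mult_strict_left_mono) auto
    then show ?thesis by (simp add: algebra_simps)
  qed
  then have "k\<^sup>2 * B t / (A t * (A t - k\<^sup>2)) < k'\<^sup>2 * B t / (A t * (A t - k'\<^sup>2))"
    using A kk by (subst frac_less_eq, auto simp: divide_simps mult_less_0_iff)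
  then show ?thesis
    by (simp add: slope_def)
qed

lemma slope_inj:
  assumes "k \<in> {0<..k_max}" "k' \<in> {0<..k_max}" "AE t in M. slope k t = slope k' t"
  shows "k = k'"
proof -
  obtain t where t: "m < t" "t < b" "a < t \<and> t < b \<longrightarrow> slope k t = slope k' t"
    using assms(3) ab(2) unfolding AE_on_Ioo_iff by (rule AE_lebesgue_Ioo_ex)
  then show ?thesis
    using slope_less[of k k' t] slope_less[of k' k t] assms ab
    by (cases k k' rule: linorder_cases) auto
qed

text \<open>Strictly below \<open>k_max\<close> the denominator stays away from 0. At
  \<open>k_max\<close> integrability is a genuine question, settled in \<open>exists_slope\<close>
  in the case where it arises.\<close>

lemma slope_integrable:
  assumes k: "0 \<le> k" "k < k_max"
  shows "integrable M (slope k)"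
proof -
  obtain C where C: "C > 0" "\<And>t. t \<in> {a..b} \<Longrightarrow> \<bar>B t\<bar> \<le> C"
    by (rule B_bounded) auto
  have Am: "k\<^sup>2 < A m"
    using A_gt[of k m] k ab' by auto
  have "norm (slope k t) \<le> sqrt (k\<^sup>2 * C / (A m * (A m - k\<^sup>2)))" if t: "t \<in> I" for t
  proof -
    have "k\<^sup>2 * B t / (A t * (A t - k\<^sup>2)) \<le> k\<^sup>2 * C / (A m * (A m - k\<^sup>2))"
      using C(1) C(2)[of t] t B_pos[OF t] A_min[OF t] Am A_pos
      by (intro frac_le mult_mono) auto
    then show ?thesis
      using slope_nonneg[of k t] t k by (simp add: slope_def)
  qed
  then show ?thesis
    by (intro finite_measure.integrable_const_bound[OF finite_M] AE_I2) auto
qed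

lemma slope_tendsto:
  assumes "x \<longlonglongrightarrow> k" "k \<in> {0..k_max}" "t \<in> I" "t \<noteq> m \<or> k < k_max"
  shows "(\<lambda>n. slope (x n) t) \<longlonglongrightarrow> slope k t"
  unfolding slope_def using A_gt[of k t] A_pos'[OF assms(3)] assms
  by (intro tendsto_intros) auto

text \<open>The last conclusion is a complementarity condition: either the slope has total mass
  \<open>s\<close>, or the parameter is extremal and the missing mass is left for a jump.\<close>

lemma exists_slope:
  obtains k where "k \<in> {0<..k_max}" "integrable M (slope k)" "(\<integral>t. slope k t \<partial>M) \<le> s"
    "(s - (\<integral>t. slope k t \<partial>M)) * (k_max - k) = 0"
proof (cases "\<exists>k1\<in>{0..<k_max}. (\<integral>t. slope k1 t \<partial>M) \<ge> s")
  case True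
  then obtain k1 where k1: "0 \<le> k1" "k1 < k_max" "(\<integral>t. slope k1 t \<partial>M) \<ge> s"
    by auto
  \<comment> \<open>Dominated convergence with the majorant \<open>slope k1\<close>; the
    intermediate value theorem then starts from integral 0 at parameter 0.\<close>
  have "continuous_on {0..k1} (\<lambda>k. \<integral>t. slope k t \<partial>M)"
    unfolding continuous_on_sequentially
  proof (intro allI impI ballI, elim conjE)
    fix x :: "nat \<Rightarrow> real" and k
    assume k: "k \<in> {0..k1}" and x: "\<forall>n. x n \<in> {0..k1}" "x \<longlonglongrightarrow> k"
    have "(\<lambda>n. \<integral>t. slope (x n) t \<partial>M) \<longlonglongrightarrow> (\<integral>t. slope k t \<partial>M)"
    proof (rule integral_dominated_convergence[where w="slope k1"])
      show "integrable M (slope k1)"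
        using k1 by (intro slope_integrable)
      show "AE t in M. (\<lambda>n. slope (x n) t) \<longlonglongrightarrow> slope k t"
        using k k1 x by (intro AE_I2 slope_tendsto) auto
      have "norm (slope (x n) t) \<le> slope k1 t" if "t \<in> I" for n t
        using slope_nonneg[of "x n" t] slope_less[of "x n" k1 t] that x(1)[rule_format, of n] k1
        by (cases "x n = k1") auto
      then show "AE t in M. norm (slope (x n) t) \<le> slope k1 t" for n
        by (intro AE_I2) auto
    qed auto
    then show "((\<lambda>k. \<integral>t. slope k t \<partial>M) \<circ> x) \<longlonglongrightarrow> (\<integral>t. slope k t \<partial>M)"
      by (simp add: o_def)
  qed
  moreover have "(\<integral>t. slope 0 t \<partial>M) = 0"
    by (simp add: slope_def)
  ultimately obtain k where k: "0 \<le> k" "k \<le> k1" "(\<integral>t. slope k t \<partial>M) = s"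
    using IVT'[of "\<lambda>k. \<integral>t. slope k t \<partial>M" 0 s k1] k1 s_pos by auto
  then have "k \<noteq> 0"
    using \<open>(\<integral>t. slope 0 t \<partial>M) = 0\<close> s_pos by auto
  then show ?thesis
    using k k1 by (intro that[of k] slope_integrable) auto
next
  case False
  then have less: "(\<integral>t. slope k t \<partial>M) < s" if "0 \<le> k" "k < k_max" for k
    using that by force
  \<comment> \<open>A sequence increasing to \<open>k_max\<close> from strictly below. The integrals
    along it are bounded by \<open>s\<close>, so monotone convergence yields both integrability at
    \<open>k_max\<close> and the bound there.\<close>
  define x where "x n = k_max * (real n / (real n + 1))" for n
  have x: "0 \<le> x n" "x n < k_max" for n
    using A_pos by (auto simp: x_def field_simps)
  have xm: "x n < x (Suc n)" for n
    using A_pos by (auto simp: x_def field_simps)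
  have "(\<lambda>n. k_max * (real n / (real n + 1))) \<longlonglongrightarrow> k_max * 1"
    using LIMSEQ_n_over_Suc_n by (intro tendsto_intros) (simp add: add.commute)
  then have xlim: "x \<longlonglongrightarrow> k_max"
    by (simp add: x_def[abs_def])
  have mono: "mono (\<lambda>n. slope (x n) t)" if "t \<in> I" for t
    using slope_less[OF x(1) xm less_imp_le[OF x(2)] that] x(2)
    by (intro incseq_SucI less_imp_le) auto
  have "incseq (\<lambda>n. \<integral>t. slope (x n) t \<partial>M)"
    using mono by (intro incseq_SucI integral_mono slope_integrable x) (auto simp: mono_iff_le_Suc)
  then obtain L where L: "(\<lambda>n. \<integral>t. slope (x n) t \<partial>M) \<longlonglongrightarrow> L"
    using incseq_convergent[of "\<lambda>n. \<integral>t. slope (x n) t \<partial>M" s] less[OF x] by (metis less_imp_le)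
  have "L \<le> s"
    using L less[OF x] by (intro LIMSEQ_le_const2[OF L]) (auto intro: less_imp_le)
  have conv: "AE t in M. (\<lambda>n. slope (x n) t) \<longlonglongrightarrow> slope k_max t"
    using AE_ne_m AE_space
    by eventually_elim (use A_pos xlim in \<open>auto intro!: slope_tendsto\<close>)
  have "AE t in M. mono (\<lambda>n. slope (x n) t)"
    using mono by (intro AE_I2) auto
  note mc = integrable_monotone_convergence[OF slope_integrable[OF x] this conv L slope_measurable]
    integral_monotone_convergence[OF slope_integrable[OF x] this conv L slope_measurable]
  show ?thesis
    using mc \<open>L \<le> s\<close> A_pos by (intro that[of k_max]) auto
qed

end

section \<open>Stability and recovery\<close>

text \<open>The explicit ramp that replaces the jump in \<open>recovery\<close>.\<close>

lemma integral_indicator_Icc: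
  assumes "(x::real) \<le> y" "a \<le> x"
  shows "integral {a..t} (indicator {x..y} :: real \<Rightarrow> real) = max 0 (min t y - x)"
proof -
  have "{a..t} \<inter> {x..y} = {x..min t y}"
    using assms by auto
  then have "integral {a..t} (indicator {x..y} :: real \<Rightarrow> real) = measure lebesgue {x..min t y}"
    by (subst integral_indicator) (auto simp: Int_commute)
  then show ?thesis
    by (auto simp: max_def)
qed

section \<open>Lower semicontinuity and envelopes\<close>

lemma lsc_on_L1_const: "lsc_on_L1 J (\<lambda>_. c)"
  unfolding lsc_on_L1_def by (auto intro: exI[of _ 1])

lemma L1_dist_triangle:
  assumes "u \<in> L1 J" "v \<in> L1 J" "w \<in> L1 J"
  shows "L1_dist J u w \<le> L1_dist J u v + L1_dist J v w"
proof -
  have i: "integrable (lebesgue_on J) (\<lambda>t. \<bar>u t - w t\<bar>)" "integrable (lebesgue_on J) (\<lambda>t. \<bar>u t - v t\<bar>)"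
    "integrable (lebesgue_on J) (\<lambda>t. \<bar>v t - w t\<bar>)"
    using assms by (auto simp: L1_def)
  then have "L1_dist J u w \<le> (\<integral>t. \<bar>u t - v t\<bar> + \<bar>v t - w t\<bar> \<partial>lebesgue_on J)"
    unfolding L1_dist_def by (intro integral_mono) auto
  then show ?thesis
    using i by (simp add: L1_dist_def)
qed

lemma L1_dist_self [simp]: "L1_dist J u u = 0"
  by (simp add: L1_dist_def)

text \<open>Localises lower bounds: if a functional is at least \<open>c\<close> on an open ball
  around \<open>u\<close>, this is a minorant, so its envelope is at least \<open>c\<close> at
  \<open>u\<close>.\<close>

lemma lsc_on_L1_ball:
  assumes "u \<in> L1 J"
  shows "lsc_on_L1 J (\<lambda>v. if L1_dist J v u < e then c else 0)"
  unfolding lsc_on_L1_def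
proof (intro ballI allI impI)
  fix w d assume w: "w \<in> L1 J" and d: "d < (if L1_dist J w u < e then c else 0)"
  then have lt: "L1_dist J w u < e"
    by (auto split: if_splits)
  show "\<exists>r>0. \<forall>v\<in>L1 J. L1_dist J v w < r \<longrightarrow> d < (if L1_dist J v u < e then c else 0)"
  proof (intro exI[of _ "e - L1_dist J w u"] conjI ballI impI)
    fix v assume v: "v \<in> L1 J" "L1_dist J v w < e - L1_dist J w u"
    then show "d < (if L1_dist J v u < e then c else 0)"
      using L1_dist_triangle[OF v(1) w assms] d lt by simp
  qed (use lt in simp)
qed

lemma lsc_envelope_ge:
  assumes "lsc_on_L1 J H" "\<And>v. v \<in> L1 J \<Longrightarrow> H v \<le> F v"
  shows "H w \<le> lsc_envelope J F w"
  unfolding lsc_envelope_def using assms by (intro SUP_upper) auto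

text \<open>A semicontinuous minorant exceeding \<open>C\<close> at \<open>w\<close> would exceed
  some \<open>C' > C\<close> on a ball around \<open>w\<close>, contradicting the competitor found
  there.\<close>

lemma lsc_envelope_le:
  assumes w: "w \<in> L1 J" and ex: "\<And>e C'. e > 0 \<Longrightarrow> C' > C \<Longrightarrow> \<exists>v\<in>L1 J. L1_dist J v w < e \<and> F v \<le> C'"
  shows "lsc_envelope J F w \<le> C"
  unfolding lsc_envelope_def
proof (rule SUP_least)
  fix H assume "H \<in> {H. lsc_on_L1 J H \<and> (\<forall>v\<in>L1 J. H v \<le> F v)}"
  then have H: "lsc_on_L1 J H" "\<And>v. v \<in> L1 J \<Longrightarrow> H v \<le> F v"
    by auto
  show "H w \<le> C"
  proof (rule ccontr)
    assume "\<not> H w \<le> C"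
    then have "C < H w" by simp
    then obtain C' where C': "C < C'" "C' < H w"
      using dense by blast
    then obtain e where e: "e > 0" "\<And>v. v \<in> L1 J \<Longrightarrow> L1_dist J v w < e \<Longrightarrow> C' < H v"
      using H(1) w unfolding lsc_on_L1_def by blast
    obtain v where v: "v \<in> L1 J" "L1_dist J v w < e" "F v \<le> C'"
      using ex[OF e(1) C'(1)] by blast
    show False
      using e(2)[OF v(1,2)] H(2)[OF v(1)] v(3) by simp
  qed
qed

text \<open>Triangle inequality for \<open>(sqrt A * x, sqrt B)\<close> and
  \<open>(sqrt A * y, 0)\<close>; it bounds the cost of the extra slope that imitates a
  jump.\<close>

lemma sqrt_quadratic_add_le:
  fixes A B x y :: real
  assumes "A \<ge> 0" "B \<ge> 0" "y \<ge> 0"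
  shows "sqrt (A * (x + y)\<^sup>2 + B) \<le> sqrt (A * x\<^sup>2 + B) + sqrt A * y"
proof -
  have "sqrt ((sqrt A * x + sqrt A * y)\<^sup>2 + (sqrt B + 0)\<^sup>2)
      \<le> sqrt ((sqrt A * x)\<^sup>2 + (sqrt B)\<^sup>2) + sqrt ((sqrt A * y)\<^sup>2 + 0\<^sup>2)"
    by (rule real_sqrt_sum_squares_triangle_ineq)
  then show ?thesis
    using assms by (simp add: power_mult_distrib distrib_left[symmetric] real_sqrt_mult)
qed

section \<open>The lower bound by calibration\<close>

context profile
begin

definition G :: "(real \<Rightarrow> real) \<Rightarrow> ennreal" where
  "G w = (if w \<in> W11 I \<and> trace_right w a 0 \<and> trace_left w b s
     then \<integral>\<^sup>+ t. ennreal (sqrt (A t * \<bar>weak_deriv I w t\<bar>\<^sup>2 + B t)) \<partial>M else \<infinity>)"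

text \<open>Reduces a competitor of finite energy to its density \<open>v'\<close> with prescribed
  integral, the form in which all later estimates work.\<close>

lemma G_finite:
  assumes v: "G v < \<infinity>"
  obtains v' \<gamma> where "v' \<in> L1 I" "AE t in M. v t = integral {a..t} v'" "integral {a..b} v' = s"
    "integrable M (\<lambda>t. sqrt (A t * (v' t)\<^sup>2 + B t))"
    "\<gamma> = (\<integral>t. sqrt (A t * (v' t)\<^sup>2 + B t) \<partial>M)" "\<gamma> \<ge> 0" "G v = ennreal \<gamma>"
proof -
  define v' where "v' = weak_deriv I v"
  let ?N = "\<lambda>t. sqrt (A t * (v' t)\<^sup>2 + B t)"
  have v1: "v \<in> W11 I" "trace_right v a 0" "trace_left v b s"
    using v by (auto simp: G_def split: if_splits)
  note p = W11_traces_primitive[OF v1 ab'(1) v'_def]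
  have Gv: "G v = (\<integral>\<^sup>+ t. ennreal (?N t) \<partial>M)"
    using v1 by (simp add: G_def v'_def)
  have [measurable]: "v' \<in> borel_measurable M"
    using p(1) by (auto simp: L1_def)
  have N0: "AE t in M. ?N t \<ge> 0"
    using A_pos' B_pos by (intro AE_I2) (auto intro!: add_nonneg_nonneg simp: less_imp_le)
  have N: "integrable M ?N"
    using v Gv N0 by (intro integrableI_nonneg) auto
  have G: "G v = ennreal (\<integral>t. ?N t \<partial>M)"
    unfolding Gv by (rule nn_integral_eq_integral[OF N N0])
  show ?thesis
    by (rule that[OF p(1) _ _ N refl _ G])
      (use p N0 in \<open>auto intro!: integral_nonneg_AE\<close>)
qed

text \<open>In the integrated calibration inequality the linear term sees the competitor only
  through its total increment \<open>s\<close>.\<close>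

lemma energy_bound_le:
  assumes k: "k \<in> {0..k_max}" and v: "v' \<in> L1 I" "integral {a..b} v' = s"
    "integrable M (\<lambda>t. sqrt (A t * (v' t)\<^sup>2 + B t))"
  shows "energy_bound k \<le> (\<integral>t. sqrt (A t * (v' t)\<^sup>2 + B t) \<partial>M)"
proof -
  have iv: "integrable M v'"
    using v(1) by (simp add: L1_def)
  have "energy_bound k = (\<integral>t. k * v' t + rest k t \<partial>M)"
    using iv rest_integrable[OF k] v(1,2) by (simp add: energy_bound_def integral_L1)
  also have "\<dots> \<le> (\<integral>t. sqrt (A t * (v' t)\<^sup>2 + B t) \<partial>M)"
  proof (rule integral_mono)
    fix t assume "t \<in> space M"
    then have t: "t \<in> I" by simp
    show "k * v' t + rest k t \<le> sqrt (A t * (v' t)\<^sup>2 + B t)"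
      unfolding rest_def using k_sq[OF k] A_min[OF t] A_pos'[OF t] B_pos[OF t]
      by (intro calibration_pointwise) auto
  qed (use iv rest_integrable[OF k] v(3) in auto)
  finally show ?thesis .
qed

lemma energy_bound_le_G:
  assumes "k \<in> {0..k_max}"
  shows "ennreal (energy_bound k) \<le> G v"
proof (cases "G v < \<infinity>")
  case True
  then show ?thesis
    by (rule G_finite) (use energy_bound_le[OF assms] in \<open>auto intro: ennreal_leI\<close>)
qed (simp add: not_less top_unique)

lemma energy_bound_nonneg: "k \<in> {0..k_max} \<Longrightarrow> energy_bound k \<ge> 0"
  using s_pos rest_nonneg by (auto simp: energy_bound_def intro!: add_nonneg_nonneg integral_nonneg_AE AE_I2)

end

section \<open>The candidate and the stability estimate\<close>

locale minimizer = profile +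
  fixes k :: real
  assumes k: "k \<in> {0<..k_max}" and slope_int: "integrable M (slope k)"
    and slope_le: "(\<integral>t. slope k t \<partial>M) \<le> s"
    and complementary: "(s - (\<integral>t. slope k t \<partial>M)) * (k_max - k) = 0"
begin

lemma k0: "k \<in> {0..k_max}" "k \<ge> 0" "k > 0"
  using k by auto

definition jump :: real where "jump = s - (\<integral>t. slope k t \<partial>M)"

text \<open>The value \<open>1/2\<close> at the jump point makes the odd symmetry exact at
  \<open>m\<close> and yields \<open>w m = s / 2\<close> in every case.\<close>

definition w :: "real \<Rightarrow> real" where
  "w t = integral {a..t} (slope k) + jump * (if t < m then 0 else if t = m then 1/2 else 1)"

lemma jump_nonneg: "jump \<ge> 0"
  using slope_le by (simp add: jump_def)

lemma slope_L1: "slope k \<in> L1 I"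
  using slope_int by (simp add: L1_def)

lemma integral_slope: "integral {a..b} (slope k) = s - jump"
  by (simp add: jump_def integral_L1[OF slope_L1])

lemma step_measurable [measurable]:
  "(\<lambda>t. if t < m then 0 else if t = m then 1/2 else (1::real)) \<in> borel_measurable M"
  by (intro measurable_restrict_space1 measurable_completion) measurable

lemma step_integrable: "integrable M (\<lambda>t. if t < m then 0 else if t = m then 1/2 else (1::real))"
  by (rule finite_measure.integrable_const_bound[OF finite_M, of _ 1]) auto

lemma primitive_slope_L1: "(\<lambda>t. integral {a..t} (slope k)) \<in> L1 I"
  by (intro L1_continuous primitive_continuous slope_L1)

lemma w_L1: "w \<in> L1 I"
  unfolding w_def
  by (rule L1_add[OF primitive_slope_L1 L1_cmult]) (use step_integrable in \<open>simp add: L1_def\<close>)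

text \<open>At distance at least \<open>\<delta>\<close> from \<open>m\<close> the factor
  \<open>sqrt (A t - k\<^sup>2)\<close> is bounded below by its value at
  \<open>m + \<delta>\<close>. The right side of the pointwise estimate is nonnegative, so its
  integral over the whole interval dominates the one over \<open>{x<..<y}\<close>.\<close>

lemma slope_dist:
  assumes v: "v' \<in> L1 I" "integral {a..b} v' = s" "integrable M (\<lambda>t. sqrt (A t * (v' t)\<^sup>2 + B t))"
    and \<gamma>: "\<gamma> = (\<integral>t. sqrt (A t * (v' t)\<^sup>2 + B t) \<partial>M)" and \<eta>: "\<eta> > 0"
    and xy: "a \<le> x" "y \<le> b" "x \<le> y" and \<delta>: "\<delta> > 0" "m + \<delta> < b" "\<And>t. t \<in> {x<..<y} \<Longrightarrow> \<bar>t - m\<bar> \<ge> \<delta>"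
  shows "sqrt (A (m + \<delta>) - k\<^sup>2) * \<bar>integral {x..y} v' - integral {x..y} (slope k)\<bar>
    \<le> (\<gamma> - energy_bound k) / \<eta> + \<eta> / 2 * \<gamma>"
proof -
  let ?N = "\<lambda>t. sqrt (A t * (v' t)\<^sup>2 + B t)"
  define H where "H t = (?N t - (k * v' t + rest k t)) / \<eta> + \<eta> / 2 * ?N t" for t
  have iv: "integrable M v'"
    using v(1) by (simp add: L1_def)
  note int = iv rest_integrable[OF k0(1)] v(3)
  have iH: "integrable M H"
    unfolding H_def using int by simp
  have "(\<integral>t. H t \<partial>M) = (\<gamma> - energy_bound k) / \<eta> + \<eta> / 2 * \<gamma>"
    unfolding H_def energy_bound_def using int v(1,2) by (simp add: integral_L1 \<gamma>)
  define D where "D = sqrt (A (m + \<delta>) - k\<^sup>2)"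
  have J: "{x<..<y} \<subseteq> I"
    using xy by auto
  have L: "v' \<in> L1 {x<..<y}" "slope k \<in> L1 {x<..<y}"
    using v(1) slope_L1 xy unfolding L1_iff by (auto intro: absolutely_integrable_on_subinterval)
  have ptw: "D * \<bar>v' t - slope k t\<bar> \<le> H t" if t: "t \<in> {x<..<y}" for t
  proof -
    have tI: "t \<in> I"
      using t J by auto
    have "D \<le> sqrt (A t - k\<^sup>2)"
      unfolding D_def using \<delta>(1,2) \<delta>(3)[OF t] tI by (intro real_sqrt_le_mono diff_right_mono A_mono) auto
    then have "D * \<bar>v' t - slope k t\<bar> \<le> sqrt (A t - k\<^sup>2) * \<bar>v' t - slope k t\<bar>"
      by (intro mult_right_mono) auto
    also have "\<dots> \<le> H t"
      unfolding H_def rest_def slope_def using k_sq[OF k0(1)] A_min[OF tI] A_pos'[OF tI] B_pos[OF tI] \<eta> k0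
      by (intro calibration_pointwise) auto
    finally show ?thesis .
  qed
  have H0: "H t \<ge> 0" if t: "t \<in> I" for t
  proof -
    have "k * v' t + rest k t \<le> ?N t"
      unfolding rest_def using k_sq[OF k0(1)] A_min[OF t] A_pos'[OF t] B_pos[OF t]
      by (intro calibration_pointwise) auto
    then show ?thesis
      using \<eta> A_pos'[OF t] B_pos[OF t] by (simp add: H_def)
  qed
  have D0: "D \<ge> 0"
    using k_sq[OF k0(1)] A_min[of "m + \<delta>"] \<delta>(1,2) ab by (simp add: D_def)
  have "integral {x..y} v' - integral {x..y} (slope k) = (\<integral>t. v' t - slope k t \<partial>lebesgue_on {x<..<y})"
    using L by (simp add: integral_L1[symmetric] L1_def)
  then have "\<bar>integral {x..y} v' - integral {x..y} (slope k)\<bar> \<le> (\<integral>t. \<bar>v' t - slope k t\<bar> \<partial>lebesgue_on {x<..<y})"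
    by (simp add: integral_abs_bound)
  then have "D * \<bar>integral {x..y} v' - integral {x..y} (slope k)\<bar>
      \<le> (\<integral>t. D * \<bar>v' t - slope k t\<bar> \<partial>lebesgue_on {x<..<y})"
    using D0 by (simp add: mult_left_mono)
  also have "\<dots> \<le> (\<integral>t. H t \<partial>M)"
    using ptw H0 J iH by (intro integral_mono_lebesgue_on_AE AE_I2) auto
  also have "\<dots> = (\<gamma> - energy_bound k) / \<eta> + \<eta> / 2 * \<gamma>"
    by fact
  finally show ?thesis
    by (simp add: D_def)
qed

text \<open>Left of \<open>m\<close> integrate from \<open>a\<close> to \<open>t\<close>; right of
  \<open>m\<close> integrate from \<open>t\<close> to \<open>b\<close>, using that both functions
  reach \<open>s\<close> at \<open>b\<close>. Neither interval meets the neighbourhood of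
  \<open>m\<close>, so the jump is never crossed.\<close>

lemma stability:
  assumes Gv: "G v \<le> ennreal \<gamma>" "\<gamma> \<ge> 0" and \<eta>: "\<eta> > 0" and \<delta>: "\<delta> > 0" "m + \<delta> < b"
  shows "AE t in M. \<bar>t - m\<bar> \<ge> \<delta> \<longrightarrow>
    sqrt (A (m + \<delta>) - k\<^sup>2) * \<bar>v t - w t\<bar> \<le> (\<gamma> - energy_bound k) / \<eta> + \<eta> / 2 * \<gamma>"
proof -
  have "G v < \<infinity>"
    using Gv(1) by (metis ennreal_less_top infinity_ennreal_def le_less_trans)
  then obtain v' \<gamma>' where v: "v' \<in> L1 I" "AE t in M. v t = integral {a..t} v'" "integral {a..b} v' = s"
    "integrable M (\<lambda>t. sqrt (A t * (v' t)\<^sup>2 + B t))"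
    "\<gamma>' = (\<integral>t. sqrt (A t * (v' t)\<^sup>2 + B t) \<partial>M)" "\<gamma>' \<ge> 0" "G v = ennreal \<gamma>'"
    by (rule G_finite)
  have "\<gamma>' \<le> \<gamma>"
    using Gv v(6,7) by simp
  then have le: "(\<gamma>' - energy_bound k) / \<eta> + \<eta> / 2 * \<gamma>' \<le> (\<gamma> - energy_bound k) / \<eta> + \<eta> / 2 * \<gamma>"
    using \<eta> by (intro add_mono divide_right_mono mult_left_mono) auto
  note sd = slope_dist[OF v(1,3,4,5) \<eta>]
  have i: "v' integrable_on {a..b}" "slope k integrable_on {a..b}"
    using L1_integrable_subinterval[OF v(1)] L1_integrable_subinterval[OF slope_L1] by auto
  show ?thesis
    using v(2) AE_space
  proof eventually_elim
    fix t assume t: "v t = integral {a..t} v'" "t \<in> space M"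
    then have tI: "t \<in> I" by simp
    show "\<bar>t - m\<bar> \<ge> \<delta> \<longrightarrow>
      sqrt (A (m + \<delta>) - k\<^sup>2) * \<bar>v t - w t\<bar> \<le> (\<gamma> - energy_bound k) / \<eta> + \<eta> / 2 * \<gamma>"
    proof
      assume td: "\<bar>t - m\<bar> \<ge> \<delta>"
      show "sqrt (A (m + \<delta>) - k\<^sup>2) * \<bar>v t - w t\<bar> \<le> (\<gamma> - energy_bound k) / \<eta> + \<eta> / 2 * \<gamma>"
      proof (cases "t < m")
        case True
        then have "v t - w t = integral {a..t} v' - integral {a..t} (slope k)"
          using t by (simp add: w_def)
        then show ?thesis
          using sd[of a t \<delta>] tI td \<delta> True le by auto
      next
        case False
        then have "t > m"
          using td \<delta> by (cases "t = m") auto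
        have "integral {a..t} v' + integral {t..b} v' = s"
          using Henstock_Kurzweil_Integration.integral_combine[of a t b v'] tI i v(3) by auto
        moreover have "integral {a..t} (slope k) + integral {t..b} (slope k) = s - jump"
          using Henstock_Kurzweil_Integration.integral_combine[of a t b "slope k"] tI i integral_slope by auto
        ultimately have "v t - w t = - (integral {t..b} v' - integral {t..b} (slope k))"
          using t \<open>t > m\<close> by (simp add: w_def)
        then have "\<bar>v t - w t\<bar> = \<bar>integral {t..b} v' - integral {t..b} (slope k)\<bar>"
          by (simp only: abs_minus_cancel)
        then show ?thesis
          using sd[of t b \<delta>] tI td \<delta> \<open>t > m\<close> le by auto
      qed
    qed
  qed
qed

text \<open>Off some neighbourhood of \<open>m\<close> the functions \<open>u\<close> and
  \<open>w\<close> differ by a positive amount \<open>\<rho>\<close> in L1. A competitor of energy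
  close to the bound is within \<open>3/8 * \<rho>\<close> of \<open>w\<close> there, and so cannot
  be within \<open>\<rho> / 2\<close> of \<open>u\<close>.\<close>

lemma G_gap:
  assumes u: "u \<in> L1 I" and ne: "\<not> (AE t in M. u t = w t)"
  obtains e C where "e > 0" "C > energy_bound k" "C \<ge> 0" "\<And>z. z \<in> L1 I \<Longrightarrow> L1_dist I z u < e \<Longrightarrow> ennreal C \<le> G z"
proof -
  define f where "f \<delta> t = (if \<delta> \<le> \<bar>t - m\<bar> then \<bar>u t - w t\<bar> else 0)" for \<delta> t
  have [measurable]: "u \<in> borel_measurable M" "w \<in> borel_measurable M"
    using u w_L1 by (auto simp: L1_def)
  have sets[measurable]: "(\<lambda>t. \<delta> \<le> \<bar>t - m\<bar>) \<in> measurable M (count_space UNIV)" for \<delta>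
    by (intro measurable_restrict_space1 measurable_completion) measurable
  have uw: "integrable M (\<lambda>t. \<bar>u t - w t\<bar>)"
    using u w_L1 by (auto simp: L1_def)
  have fi: "integrable M (f \<delta>)" for \<delta>
  proof (rule Bochner_Integration.integrable_bound[OF uw])
    show "f \<delta> \<in> borel_measurable M"
      unfolding f_def by measurable
  qed (auto simp: f_def)
  have f0: "f \<delta> t \<ge> 0" for \<delta> t
    by (simp add: f_def)
  have "\<exists>\<delta>>0. m + \<delta> < b \<and> (\<integral>t. f \<delta> t \<partial>M) > 0"
  proof (rule ccontr)
    assume "\<not> ?thesis"
    then have le: "\<not> (\<integral>t. f \<delta> t \<partial>M) > 0" if "\<delta> > 0" "m + \<delta> < b" for \<delta>
      using that by blast
    have ge: "(\<integral>t. f \<delta> t \<partial>M) \<ge> 0" for \<delta>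
      by (intro integral_nonneg_AE AE_I2 f0)
    have z: "(\<integral>t. f \<delta> t \<partial>M) = 0" if "\<delta> > 0" "m + \<delta> < b" for \<delta>
      using le[OF that] ge[of \<delta>] by simp
    \<comment> \<open>The shift by 2 keeps \<open>\<delta> n\<close> below \<open>b - m\<close>
      already for \<open>n = 0\<close>.\<close>
    define \<delta> where "\<delta> n = (b - m) / real (n + 2)" for n
    have \<delta>: "\<delta> n > 0" "m + \<delta> n < b" for n
    proof -
      show "\<delta> n > 0"
        using ab by (simp add: \<delta>_def)
      have "\<delta> n < (b - m) / 1"
        unfolding \<delta>_def using ab by (intro divide_strict_left_mono) auto
      then show "m + \<delta> n < b"
        by simp
    qed
    have "AE t in M. f (\<delta> n) t = 0" for n
      using z[OF \<delta>] fi f0 by (subst integral_nonneg_eq_0_iff_AE[symmetric]) auto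
    then have "AE t in M. \<forall>n. f (\<delta> n) t = 0"
      by (simp add: AE_all_countable)
    then have "AE t in M. u t = w t"
      using AE_ne_m
    proof eventually_elim
      fix t assume t: "\<forall>n. f (\<delta> n) t = 0" "t \<noteq> m"
      have "\<delta> \<longlonglongrightarrow> 0"
        unfolding \<delta>_def using LIMSEQ_ignore_initial_segment[OF lim_const_over_n[of "b - m"], of 2] by simp
      then have "eventually (\<lambda>n. \<delta> n < \<bar>t - m\<bar>) sequentially"
        using t(2) by (intro order_tendstoD) auto
      then obtain n where "\<delta> n < \<bar>t - m\<bar>"
        by (auto simp: eventually_sequentially)
      then show "u t = w t"
        using t(1)[rule_format, of n] by (simp add: f_def)
    qed
    with ne show False by simp
  qed
  then obtain \<delta> where \<delta>: "\<delta> > 0" "m + \<delta> < b" and pos: "(\<integral>t. f \<delta> t \<partial>M) > 0"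
    by blast
  define \<rho> where "\<rho> = (\<integral>t. f \<delta> t \<partial>M)"
  define D where "D = sqrt (A (m + \<delta>) - k\<^sup>2)"
  define E where "E = energy_bound k"
  have E: "E \<ge> 0"
    unfolding E_def by (rule energy_bound_nonneg[OF k0(1)])
  have D: "D > 0"
    using A_gt[OF k0(1), of "m + \<delta>"] \<delta> ab by (simp add: D_def)
  have \<rho>: "\<rho> > 0"
    using pos by (simp add: \<rho>_def)
  \<comment> \<open>Converts the pointwise bound \<open>R / D\<close> into the L1 bound
    \<open>(b - a) * (R / D) = l * R\<close>.\<close>
  define l where "l = (b - a) / D"
  have l: "l > 0"
    using D ab by (simp add: l_def)
  \<comment> \<open>First \<open>\<eta>\<close> makes the term proportional to the energy contribute
    at most \<open>\<rho> / 4\<close>; then \<open>\<epsilon>\<close>, depending on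
    \<open>\<eta>\<close>, makes the deficit term contribute at most \<open>\<rho> / 8\<close>. The
    cap 1 on \<open>\<epsilon>\<close> permits \<open>E + 1\<close> in the choice of
    \<open>\<eta>\<close>.\<close>
  define \<eta> where "\<eta> = \<rho> / (2 * l * (E + 1))"
  have \<eta>: "\<eta> > 0"
    using \<rho> l E by (simp add: \<eta>_def)
  define \<epsilon> where "\<epsilon> = min 1 (\<rho> * \<eta> / (8 * l))"
  have \<epsilon>: "\<epsilon> > 0" "\<epsilon> \<le> 1" "\<epsilon> \<le> \<rho> * \<eta> / (8 * l)"
    using \<rho> \<eta> l by (auto simp: \<epsilon>_def)
  define R where "R = \<epsilon> / \<eta> + \<eta> / 2 * (E + \<epsilon>)"
  have "l * R \<le> \<rho> / 8 + \<rho> / 4"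
  proof -
    have "l * (\<epsilon> / \<eta>) \<le> l * (\<rho> * \<eta> / (8 * l) / \<eta>)"
      using \<epsilon> \<eta> l by (intro mult_left_mono divide_right_mono) auto
    also have "\<dots> = \<rho> / 8"
      using \<eta> l by simp
    finally have 1: "l * (\<epsilon> / \<eta>) \<le> \<rho> / 8" .
    have "l * (\<eta> / 2 * (E + \<epsilon>)) \<le> l * (\<eta> / 2 * (E + 1))"
      using \<epsilon> \<eta> l by (intro mult_left_mono) auto
    also have "\<dots> = \<rho> / 4"
      using l E by (simp add: \<eta>_def)
    finally show ?thesis
      using 1 by (simp add: R_def distrib_left)
  qed
  have "ennreal (E + \<epsilon>) \<le> G z" if z: "z \<in> L1 I" "L1_dist I z u < \<rho> / 2" for z
  proof (rule ccontr)
    assume "\<not> ennreal (E + \<epsilon>) \<le> G z"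
    then have "G z \<le> ennreal (E + \<epsilon>)" by simp
    from stability[OF this _ \<eta> \<delta>] have st: "AE t in M. \<bar>t - m\<bar> \<ge> \<delta> \<longrightarrow> D * \<bar>z t - w t\<bar> \<le> R"
      using E \<epsilon> by (simp add: D_def R_def E_def)
    have iz: "integrable M (\<lambda>t. \<bar>z t - u t\<bar>)"
      using z u by (auto simp: L1_def)
    have R0: "R \<ge> 0"
      using \<epsilon> \<eta> E by (simp add: R_def)
    have "\<rho> \<le> (\<integral>t. \<bar>z t - u t\<bar> + R / D \<partial>M)"
      unfolding \<rho>_def
    proof (rule integral_mono_AE)
      show "AE t in M. f \<delta> t \<le> \<bar>z t - u t\<bar> + R / D"
        using st
      proof eventually_elim
        fix t assume "\<bar>t - m\<bar> \<ge> \<delta> \<longrightarrow> D * \<bar>z t - w t\<bar> \<le> R"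
        then have "\<bar>t - m\<bar> \<ge> \<delta> \<Longrightarrow> \<bar>z t - w t\<bar> \<le> R / D"
          using D by (simp add: field_simps)
        then show "f \<delta> t \<le> \<bar>z t - u t\<bar> + R / D"
          using R0 D by (auto simp: f_def)
      qed
    qed (use fi iz finite_M in \<open>auto simp: finite_measure.integrable_const\<close>)
    also have "\<dots> = L1_dist I z u + (b - a) * (R / D)"
      using iz finite_M ab' by (simp add: L1_dist_def finite_measure.integrable_const measure_restrict_space)
    also have "(b - a) * (R / D) = l * R"
      by (simp add: l_def)
    finally show False
      using z(2) \<open>l * R \<le> _\<close> \<rho> by simp
  qed
  then show ?thesis
    using \<rho> \<epsilon> E by (intro that[of "\<rho> / 2" "E + \<epsilon>"]) (auto simp: E_def)
qed

text \<open>The jump is spread linearly over a window of width \<open>2 * h\<close>. There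
  \<open>A\<close> is at most \<open>A (m + h)\<close>, so the ramp costs at most
  \<open>sqrt (A (m + h)) * jump\<close>, while the slope alone already saves
  \<open>k * jump\<close> compared with the bound.\<close>

lemma recovery:
  assumes h: "h > 0" "m + h < b"
  obtains v where "v \<in> L1 I" "L1_dist I v w \<le> 2 * h * jump"
    "G v \<le> ennreal (energy_bound k + jump * (sqrt (A (m + h)) - k))"
proof -
  define g where "g t = slope k t + jump / (2 * h) * indicator {m - h..m + h} t" for t
  define v where "v t = integral {a..t} g" for t
  have hI: "{m-h..m+h} \<subseteq> I"
    using h ab by auto
  have indL: "(indicator {m - h..m + h} :: real \<Rightarrow> real) \<in> L1 I"
    unfolding L1_def mem_Collect_eq
  proof (rule finite_measure.integrable_const_bound[OF finite_M, of _ 1])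
    show "(indicator {m - h..m + h} :: real \<Rightarrow> real) \<in> borel_measurable M"
      by (intro measurable_restrict_space1 measurable_completion) measurable
  qed (auto simp: indicator_def)
  have "(\<integral>t. indicator {m - h..m + h} t \<partial>M) = integral {a..b} (indicator {m - h..m + h} :: real \<Rightarrow> real)"
    by (rule integral_L1[OF indL])
  also have "\<dots> = 2 * h"
    using h ab by (subst integral_indicator_Icc) auto
  finally have ind_int: "(\<integral>t. indicator {m - h..m + h} t \<partial>M) = 2 * h" .
  have gL: "g \<in> L1 I"
    unfolding g_def by (intro L1_add slope_L1 L1_cmult indL)
  have v_eq: "v t = integral {a..t} (slope k) + jump / (2 * h) * max 0 (min t (m + h) - (m - h))" if "t \<le> b" for t
  proof -
    have "v t = integral {a..t} (slope k) + integral {a..t} (\<lambda>t. jump / (2 * h) * indicator {m - h..m + h} t)"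
      unfolding v_def g_def
      using that L1_integrable_subinterval[OF slope_L1 order_refl] L1_integrable_subinterval[OF indL order_refl]
      by (intro Henstock_Kurzweil_Integration.integral_add integrable_on_mult_right) auto
    also have "integral {a..t} (\<lambda>t. jump / (2 * h) * indicator {m - h..m + h} t)
      = jump / (2 * h) * integral {a..t} (indicator {m - h..m + h})"
      by simp
    also have "integral {a..t} (indicator {m - h..m + h} :: real \<Rightarrow> real) = max 0 (min t (m + h) - (m - h))"
      using h ab by (intro integral_indicator_Icc) auto
    finally show ?thesis .
  qed
  have gs: "integral {a..b} g = s"
    using v_eq[of b] h jump_nonneg by (simp add: v_def integral_slope)
  note W = primitive_W11[OF gL ab'(1), folded v_def[abs_def], unfolded gs]
  have vL: "v \<in> L1 I"
    using W(1) by (simp add: W11_def)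
  have [measurable]: "(indicator {m - h..m + h} :: real \<Rightarrow> real) \<in> borel_measurable M"
    using indL by (auto simp: L1_def)
  have "L1_dist I v w \<le> (\<integral>t. jump * indicator {m - h..m + h} t \<partial>M)"
    unfolding L1_dist_def
  proof (rule integral_mono)
    fix t assume "t \<in> space M"
    then have t: "t \<in> I" by simp
    \<comment> \<open>The fraction of the jump that the ramp has completed at \<open>t\<close>; it
      agrees with the step function outside the window.\<close>
    define q where "q = max 0 (min t (m + h) - (m - h)) / (2 * h)"
    have q: "v t - w t = jump * (q - (if t < m then 0 else if t = m then 1/2 else 1))"
      using v_eq[of t] t by (simp add: w_def q_def algebra_simps)
    have q01: "0 \<le> q" "q \<le> 1"
      using h by (auto simp: q_def)
    show "\<bar>v t - w t\<bar> \<le> jump * indicator {m - h..m + h} t"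
    proof (cases "t \<in> {m - h..m + h}")
      case True
      have "\<bar>q - (if t < m then 0 else if t = m then 1/2 else 1)\<bar> \<le> 1"
        using q01 by auto
      then show ?thesis
        using True jump_nonneg by (simp add: q abs_mult mult_left_le)
    next
      case False
      then have "q = (if t < m then 0 else if t = m then 1/2 else 1)"
        using h by (auto simp: q_def)
      then show ?thesis
        using False by (simp add: q)
    qed
  qed (use vL w_L1 indL in \<open>auto simp: L1_def\<close>)
  also have "\<dots> = jump * (\<integral>t. indicator {m - h..m + h} t \<partial>M)"
    by (rule integral_mult_right_zero)
  also note ind_int
  finally have dist: "L1_dist I v w \<le> 2 * h * jump"
    by (simp add: mult_ac)
  define F where "F t = k * slope k t + rest k t + jump / (2 * h) * sqrt (A (m + h)) * indicator {m - h..m + h} t" for t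
  have iF: "integrable M F"
    unfolding F_def using slope_int rest_integrable[OF k0(1)] indL by (auto simp: L1_def)
  have "A (m + h) \<ge> 0"
    using A_pos'[of "m + h"] h ab by simp
  then have F0: "AE t in M. F t \<ge> 0"
    using slope_nonneg[OF k0(1)] rest_nonneg[OF k0(1)] k0 jump_nonneg h
    by (intro AE_I2) (auto simp: F_def intro!: add_nonneg_nonneg mult_nonneg_nonneg divide_nonneg_nonneg)
  have "G v = (\<integral>\<^sup>+ t. ennreal (sqrt (A t * \<bar>weak_deriv I v t\<bar>\<^sup>2 + B t)) \<partial>M)"
    using W by (simp add: G_def)
  also have "\<dots> \<le> (\<integral>\<^sup>+ t. ennreal (F t) \<partial>M)"
  proof (rule nn_integral_mono_AE)
    show "AE t in M. ennreal (sqrt (A t * \<bar>weak_deriv I v t\<bar>\<^sup>2 + B t)) \<le> ennreal (F t)"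
      using W(4) AE_space AE_ne_m
    proof eventually_elim
      fix t assume t: "weak_deriv I v t = g t" "t \<in> space M" "t \<noteq> m"
      then have tI: "t \<in> I" by simp
      define j where "j = jump / (2 * h) * indicator {m - h..m + h} t"
      have j: "j \<ge> 0"
        using h jump_nonneg by (simp add: j_def)
      have "sqrt (A t * (g t)\<^sup>2 + B t) \<le> sqrt (A t * (slope k t)\<^sup>2 + B t) + sqrt (A t) * j"
        unfolding g_def j_def[symmetric]
        using A_pos'[OF tI] B_pos[OF tI] j by (intro sqrt_quadratic_add_le) auto
      also have "sqrt (A t * (slope k t)\<^sup>2 + B t) = k * slope k t + rest k t"
        unfolding slope_def rest_def
        using A_gt[OF k0(1) tI] t(3) A_pos'[OF tI] B_pos[OF tI] k0 by (intro calibration_eq) auto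
      also have "sqrt (A t) * j \<le> sqrt (A (m + h)) * j"
      proof (cases "t \<in> {m - h..m + h}")
        case True
        have "A t \<le> A (m + h)"
          using True hI h by (intro A_mono) auto
        then show ?thesis
          using j by (intro mult_right_mono) auto
      qed (simp add: j_def)
      finally show "ennreal (sqrt (A t * \<bar>weak_deriv I v t\<bar>\<^sup>2 + B t)) \<le> ennreal (F t)"
        using t(1) by (intro ennreal_leI) (simp add: F_def j_def mult_ac)
    qed
  qed
  also have "\<dots> = ennreal (\<integral>t. F t \<partial>M)"
    by (rule nn_integral_eq_integral[OF iF F0])
  also have "(\<integral>t. F t \<partial>M) = energy_bound k + jump * (sqrt (A (m + h)) - k)"
  proof -
    have "(\<integral>t. F t \<partial>M) = k * (\<integral>t. slope k t \<partial>M) + (\<integral>t. rest k t \<partial>M)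
      + jump / (2 * h) * sqrt (A (m + h)) * (\<integral>t. indicator {m - h..m + h} t \<partial>M)"
      unfolding F_def using slope_int rest_integrable[OF k0(1)] indL by (simp add: L1_def)
    also note ind_int
    also have "k * (\<integral>t. slope k t \<partial>M) = k * s - k * jump"
      by (simp add: jump_def algebra_simps)
    finally show ?thesis
      using h by (simp add: energy_bound_def algebra_simps)
  qed
  finally show ?thesis
    using dist vL by (intro that[of v])
qed

end

section \<open>The minimizer of the envelope\<close>

context minimizer
begin

abbreviation "E \<equiv> energy_bound k"

lemma envelope_ge: "ennreal E \<le> lsc_envelope I G v"
  by (rule lsc_envelope_ge[OF lsc_on_L1_const]) (rule energy_bound_le_G[OF k0(1)])

lemma envelope_w: "lsc_envelope I G w = ennreal E"
proof (rule antisym[OF lsc_envelope_le envelope_ge])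
  show "w \<in> L1 I"
    by (rule w_L1)
  fix e :: real and C' :: ennreal assume e: "e > 0" and C': "C' > ennreal E"
  have "isCont A m"
    using A_cont ab' by (simp add: continuous_on_eq_continuous_at)
  then have "((\<lambda>h. A (m + h)) \<longlongrightarrow> A m) (at_right 0)"
    by (simp add: isCont_iff filterlim_at_split)
  then have "((\<lambda>h. E + jump * (sqrt (A (m + h)) - k)) \<longlongrightarrow> E + jump * (k_max - k)) (at_right 0)"
    by (intro tendsto_intros)
  \<comment> \<open>Complementarity removes the limiting excess: without a jump there is none, and
    with a jump the parameter is extremal.\<close>
  moreover have "jump * (k_max - k) = 0"
    using complementary by (simp add: jump_def)
  ultimately have "((\<lambda>h. ennreal (E + jump * (sqrt (A (m + h)) - k))) \<longlongrightarrow> ennreal E) (at_right 0)"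
    by (intro tendsto_ennrealI) simp
  then have 1: "\<forall>\<^sub>F h in at_right 0. ennreal (E + jump * (sqrt (A (m + h)) - k)) < C'"
    using C' by (rule order_tendstoD)
  have "((\<lambda>h. 2 * h * jump) \<longlongrightarrow> 2 * 0 * jump) (at_right 0)"
    by (intro tendsto_intros)
  then have 2: "\<forall>\<^sub>F h in at_right 0. 2 * h * jump < e"
    using e by (intro order_tendstoD) auto
  have "\<forall>\<^sub>F h in at_right 0. h \<in> {0<..<b - m}"
    using ab by (intro eventually_at_right_real) simp
  with 1 2 have "\<forall>\<^sub>F h in at_right 0. ennreal (E + jump * (sqrt (A (m + h)) - k)) < C' \<and> 2 * h * jump < e \<and> h \<in> {0<..<b - m}"
    by eventually_elim auto
  then obtain h where h: "ennreal (E + jump * (sqrt (A (m + h)) - k)) < C'" "2 * h * jump < e" "h > 0" "m + h < b"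
    using eventually_happens'[OF trivial_limit_at_right_real] by fastforce
  obtain v where "v \<in> L1 I" "L1_dist I v w \<le> 2 * h * jump"
    "G v \<le> ennreal (E + jump * (sqrt (A (m + h)) - k))"
    using recovery[OF h(3,4)] by blast
  then show "\<exists>v\<in>L1 I. L1_dist I v w < e \<and> G v \<le> C'"
    using h by (intro bexI[of _ v]) auto
qed

lemma INF_envelope: "(INF v\<in>L1 I. lsc_envelope I G v) = ennreal E"
proof (rule antisym)
  show "(INF v\<in>L1 I. lsc_envelope I G v) \<le> ennreal E"
    using INF_lower[OF w_L1, of "lsc_envelope I G"] by (simp add: envelope_w)
  show "ennreal E \<le> (INF v\<in>L1 I. lsc_envelope I G v)"
    by (intro INF_greatest envelope_ge)
qed

text \<open>The gap around any other \<open>u\<close> supplies a ball minorant whose value at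
  \<open>u\<close> exceeds the minimum.\<close>

lemma envelope_unique:
  assumes u: "u \<in> L1 I" and eq: "lsc_envelope I G u = ennreal E"
  shows "AE t in M. u t = w t"
proof (rule ccontr)
  assume "\<not> ?thesis"
  then obtain e C where e: "e > 0" "C > E" "C \<ge> 0" "\<And>z. z \<in> L1 I \<Longrightarrow> L1_dist I z u < e \<Longrightarrow> ennreal C \<le> G z"
    by (rule G_gap[OF u]) auto
  have "(if L1_dist I u u < e then ennreal C else 0) \<le> lsc_envelope I G u"
    by (rule lsc_envelope_ge[OF lsc_on_L1_ball[OF u]]) (use e(4) in auto)
  then have "ennreal C \<le> ennreal E"
    using e(1) eq by simp
  then show False
    using e(2,3) energy_bound_nonneg[OF k0(1)] by simp
qed

section \<open>Symmetry, monotonicity and boundary values of the minimizer\<close>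

lemma slope_sym: "slope k (2 * m - t) = slope k t"
  by (simp add: slope_def A_sym B_sym)

lemma slope_integrable_on: "a \<le> x \<Longrightarrow> y \<le> b \<Longrightarrow> slope k integrable_on {x..y}"
  by (rule L1_integrable_subinterval[OF slope_L1])

text \<open>The reflection at \<open>m\<close> carries \<open>{t..b}\<close> to
  \<open>{a..2 * m - t}\<close> and preserves the slope.\<close>

lemma integral_slope_sym:
  assumes "t \<in> {a..b}"
  shows "integral {a..2 * m - t} (slope k) = s - jump - integral {a..t} (slope k)"
proof -
  have "(slope k has_integral integral {t..b} (slope k)) (cbox t b)"
    using slope_integrable_on[of t b] assms by (simp add: integrable_integral)
  from has_integral_affinity[OF this, of "-1" "2 * m"]
  have 1: "((\<lambda>x. slope k (2 * m - x)) has_integral integral {t..b} (slope k)) ((\<lambda>x. 2 * m - x) ` {t..b})"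
    by (simp add: algebra_simps)
  have "2 * m - b = a"
    using ab by simp
  then have 2: "(\<lambda>x. 2 * m - x) ` {t..b} = {a..2 * m - t}"
    using assms by simp
  from 1 have "integral {a..2 * m - t} (slope k) = integral {t..b} (slope k)"
    unfolding 2 slope_sym by (rule integral_unique)
  moreover have "integral {a..t} (slope k) + integral {t..b} (slope k) = s - jump"
    using Henstock_Kurzweil_Integration.integral_combine[of a t b "slope k"] assms slope_integrable_on
      integral_slope by auto
  ultimately show ?thesis by simp
qed

lemma w_sym: "t \<in> I \<Longrightarrow> w (2 * m - t) = s - w t"
  using integral_slope_sym[of t] by (auto simp: w_def algebra_simps)

lemma integral_slope_mid: "integral {a..m} (slope k) = (s - jump) / 2"
  using integral_slope_sym[of m] ab by simp

lemma w_mid: "w m = s / 2"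
  by (simp add: w_def integral_slope_mid field_simps)

text \<open>The slope is positive off the null point \<open>m\<close>, so its integral over any
  nondegenerate interval is positive; the step term can only add to the increment.\<close>

lemma w_strict_mono: "strict_mono_on I w"
proof (rule strict_mono_onI)
  fix x y assume xy: "x \<in> I" "y \<in> I" "x < y"
  have sub: "slope k \<in> L1 {x<..<y}"
    using slope_L1 xy unfolding L1_iff by (auto intro: absolutely_integrable_on_subinterval)
  have nn: "AE t in lebesgue_on {x<..<y}. slope k t \<ge> 0"
    using slope_nonneg[OF k0(1)] xy by (intro AE_I2) auto
  have "integral {x..y} (slope k) \<noteq> 0"
  proof
    assume "integral {x..y} (slope k) = 0"
    then have "AE t in lebesgue_on {x<..<y}. slope k t = 0"
      using sub nn integral_nonneg_eq_0_iff_AE[of "lebesgue_on {x<..<y}" "slope k"]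
      by (simp add: integral_L1[symmetric] L1_def)
    moreover have "AE t in lebesgue. t \<noteq> m"
      by (rule AE_completion[OF AE_lborel_singleton])
    ultimately have "AE t in lebesgue. (x < t \<and> t < y \<longrightarrow> slope k t = 0) \<and> t \<noteq> m"
      unfolding AE_on_Ioo_iff by eventually_elim simp
    then obtain t where "x < t" "t < y" "(x < t \<and> t < y \<longrightarrow> slope k t = 0) \<and> t \<noteq> m"
      using \<open>x < y\<close> by (rule AE_lebesgue_Ioo_ex)
    then show False
      using slope_pos[OF k, of t] xy by auto
  qed
  moreover have "integral {x..y} (slope k) \<ge> 0"
    using integral_nonneg_AE[OF nn] sub by (simp add: integral_L1)
  moreover have "integral {a..x} (slope k) + integral {x..y} (slope k) = integral {a..y} (slope k)"
    using xy by (intro Henstock_Kurzweil_Integration.integral_combine slope_integrable_on) auto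
  moreover have "jump * (if x < m then 0 else if x = m then 1/2 else 1) \<le> jump * (if y < m then 0 else if y = m then 1/2 else 1)"
    using jump_nonneg xy(3) by (intro mult_left_mono) auto
  ultimately show "w x < w y"
    by (simp add: w_def)
qed

text \<open>Only the half up to \<open>m\<close> is used, since a continuous representative on the
  whole interval may fail to exist.\<close>

lemma w_trace_right: "trace_right w a 0"
proof -
  have "continuous_on {a..m} (\<lambda>t. integral {a..t} (slope k))"
    using primitive_continuous[OF slope_L1] by (rule continuous_on_subset) (use ab in auto)
  moreover have "AE t in lebesgue_on {a<..<m}. w t = integral {a..t} (slope k)"
    by (intro AE_I2) (simp add: w_def)
  ultimately show ?thesis
    using trace_rightI[OF ab(1), of "\<lambda>t. integral {a..t} (slope k)" w] by simp
qed

lemma w_trace_left: "trace_left w b s"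
proof -
  have "continuous_on {m..b} (\<lambda>t. integral {a..t} (slope k))"
    using primitive_continuous[OF slope_L1] by (rule continuous_on_subset) (use ab in auto)
  then have "continuous_on {m..b} (\<lambda>t. integral {a..t} (slope k) + jump)"
    by (intro continuous_intros)
  moreover have "AE t in lebesgue_on {m<..<b}. w t = integral {a..t} (slope k) + jump"
    by (intro AE_I2) (simp add: w_def)
  ultimately show ?thesis
    using trace_leftI[OF ab(2), of "\<lambda>t. integral {a..t} (slope k) + jump" w]
    by (simp add: integral_slope)
qed

section \<open>Regularity and distributional derivative of the minimizer\<close>

lemma w_W11: "jump = 0 \<Longrightarrow> w \<in> W11 I"
  using primitive_W11(1)[OF slope_L1 ab'(1)] by (simp add: w_def[abs_def])

text \<open>This is \<open>jump\<close> times the Dirac measure at \<open>m\<close>. The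
  push-forward provides the Borel sets of the interval as its sigma-algebra, as
  \<open>has_BV_deriv\<close> demands.\<close>

definition jump_measure :: "real measure" where
  "jump_measure = distr (point_measure {m} (\<lambda>_. ennreal jump)) (restrict_space borel I) (\<lambda>t. t)"

lemma space_jump_measure [simp]: "space jump_measure = I"
  and sets_jump_measure [simp]: "sets jump_measure = sets (restrict_space borel I)"
  by (simp_all add: jump_measure_def space_restrict_space)

lemma measurable_id_point [measurable]:
  "(\<lambda>t. t) \<in> measurable (point_measure {m} (\<lambda>_. ennreal jump)) (restrict_space borel I)"
  using ab' by (simp add: measurable_point_measure_eq1 space_restrict_space)

lemma sets_jump_measure_iff: "X \<in> sets jump_measure \<longleftrightarrow> X \<subseteq> I \<and> X \<in> sets borel"
  by (auto simp: sets_restrict_space_iff)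

lemma emeasure_jump_measure:
  assumes "X \<subseteq> I" "X \<in> sets borel"
  shows "emeasure jump_measure X = ennreal jump * indicator X m"
proof -
  have X: "X \<in> sets (restrict_space borel I)"
    using assms by (simp add: sets_restrict_space_iff)
  then show ?thesis
    unfolding jump_measure_def
    by (subst emeasure_distr)
      (use ab in \<open>auto simp: space_point_measure emeasure_point_measure_finite Int_insert_right indicator_def\<close>)
qed

text \<open>The primitive is integrated by parts, and the step contributes \<open>jump\<close> times
  the integral of \<open>deriv \<psi>\<close> over \<open>{m..b}\<close>, which is
  \<open>- jump * \<psi> m\<close>. Since \<open>jump\<close> is nonnegative, the polar factor is
  1.\<close>

lemma w_BV_deriv: "has_BV_deriv I w (slope k) jump_measure (\<lambda>_. 1)"
  unfolding has_BV_deriv_def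
proof (intro conjI ballI)
  show "finite_measure jump_measure"
    by (rule finite_measureI)
      (subst emeasure_jump_measure, auto simp: ennreal_mult_eq_top_iff indicator_def)
  have "emeasure jump_measure (I - {m}) = 0"
    by (subst emeasure_jump_measure) auto
  then show "\<exists>N\<in>null_sets lborel. N \<subseteq> I \<and> emeasure jump_measure (I - N) = 0"
    using ab' by (intro bexI[of _ "{m}"]) auto
  fix \<psi> assume \<psi>: "\<psi> \<in> C1c I"
  note d\<psi> = C1cD[OF \<psi>]
  let ?st = "\<lambda>t. if t < m then 0 else if t = m then 1/2 else (1::real)"
  have st: "?st \<in> L1 I"
    using step_integrable by (simp add: L1_def)
  have "(\<integral>t. ?st t * deriv \<psi> t \<partial>M) = (\<integral>t. (if t \<in> {m<..<b} then deriv \<psi> t else 0) \<partial>M)"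
  proof (rule integral_cong_AE)
    show "AE t in M. ?st t * deriv \<psi> t = (if t \<in> {m<..<b} then deriv \<psi> t else 0)"
      using AE_ne_m AE_space by eventually_elim auto
    have "deriv \<psi> \<in> borel_measurable M"
      using C1c_L1(1)[OF \<psi>] by (auto simp: L1_def)
    moreover have "(\<lambda>t. t \<in> {m<..<b}) \<in> measurable M (count_space UNIV)"
      by (intro measurable_restrict_space1 measurable_completion) measurable
    ultimately show "(\<lambda>t. if t \<in> {m<..<b} then deriv \<psi> t else 0) \<in> borel_measurable M"
      by measurable
  qed (use L1_mult_continuous[OF st d\<psi>(2)] in \<open>simp add: L1_def\<close>)
  also have "\<dots> = (\<integral>t. deriv \<psi> t \<partial>lebesgue_on {m<..<b})"
    using ab by (intro integral_restrict) auto
  also have "\<dots> = integral {m..b} (deriv \<psi>)"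
    using d\<psi>(2) by (intro integral_L1 L1_continuous continuous_on_subset[OF d\<psi>(2)]) auto
  also have "\<dots> = - \<psi> m"
    using integral_deriv_C1c[OF \<psi>, of m b] d\<psi>(4)[of b] ab by simp
  finally have 1: "(\<integral>t. ?st t * deriv \<psi> t \<partial>M) = - \<psi> m" .
  have "(\<integral>t. w t * deriv \<psi> t \<partial>M)
      = (\<integral>t. integral {a..t} (slope k) * deriv \<psi> t + jump * (?st t * deriv \<psi> t) \<partial>M)"
    by (simp add: w_def algebra_simps)
  also have "\<dots> = (\<integral>t. integral {a..t} (slope k) * deriv \<psi> t \<partial>M) + jump * (\<integral>t. ?st t * deriv \<psi> t \<partial>M)"
    using L1_mult_continuous[OF primitive_slope_L1 d\<psi>(2)] L1_mult_continuous[OF st d\<psi>(2)]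
    by (subst Bochner_Integration.integral_add) (auto simp: L1_def)
  also have "\<dots> = - ((\<integral>t. slope k t * \<psi> t \<partial>M) + jump * \<psi> m)"
    by (simp only: 1 primitive_by_parts[OF slope_L1 \<psi>])
  also have "jump * \<psi> m = (\<integral>t. \<psi> t * 1 \<partial>jump_measure)"
  proof -
    have "\<psi> \<in> borel_measurable borel"
      using d\<psi>(3) by (rule borel_measurable_continuous_onI)
    then have [measurable]: "\<psi> \<in> borel_measurable (restrict_space borel I)"
      by (rule measurable_restrict_space1)
    have "(\<integral>t. \<psi> t \<partial>jump_measure) = (\<integral>t. \<psi> t \<partial>point_measure {m} (\<lambda>_. ennreal jump))"
      unfolding jump_measure_def by (rule integral_distr) measurable
    also have "\<dots> = jump * \<psi> m"
      using jump_nonneg by (simp add: lebesgue_integral_point_measure_finite)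
    finally show ?thesis by simp
  qed
  finally show "(\<integral>t. w t * deriv \<psi> t \<partial>M)
    = - ((\<integral>t. slope k t * \<psi> t \<partial>M) + (\<integral>t. \<psi> t * 1 \<partial>jump_measure))" .
qed (auto simp: slope_L1)

lemma atoms_jump_measure: "atoms jump_measure = (if jump = 0 then {} else {m})"
proof -
  have "emeasure jump_measure {t} = ennreal jump * indicator {t} m" if "t \<in> I" for t
    using that by (intro emeasure_jump_measure) auto
  then show ?thesis
    using ab' jump_nonneg by (auto simp: atoms_def indicator_def ennreal_eq_0_iff split: if_splits)
qed

text \<open>The measure charges at most the point \<open>m\<close>, and whenever it does,
  \<open>m\<close> is an atom.\<close>

lemma cantor_variation_jump_measure: "emeasure (cantor_variation jump_measure) I = 0"
proof -
  have "space jump_measure - atoms jump_measure \<in> sets jump_measure"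
    unfolding sets_jump_measure_iff by (auto simp: atoms_jump_measure)
  then have "emeasure (cantor_variation jump_measure) I
      = emeasure jump_measure ((space jump_measure - atoms jump_measure) \<inter> I)"
    unfolding cantor_variation_def
    by (rule emeasure_restricted) (simp add: sets_jump_measure_iff del: sets_jump_measure)
  also have "\<dots> = 0"
    by (subst emeasure_jump_measure) (auto simp: atoms_jump_measure)
  finally show ?thesis .
qed

lemma jump_variation_jump_measure: "emeasure (jump_variation jump_measure) (I - {m}) = 0"
proof -
  have "atoms jump_measure \<in> sets jump_measure"
    unfolding sets_jump_measure_iff using ab' by (auto simp: atoms_jump_measure)
  then have "emeasure (jump_variation jump_measure) (I - {m}) = emeasure jump_measure (atoms jump_measure \<inter> (I - {m}))"
    unfolding jump_variation_def
    by (rule emeasure_restricted) (auto simp: sets_jump_measure_iff simp del: sets_jump_measure)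
  also have "atoms jump_measure \<inter> (I - {m}) = {}"
    by (auto simp: atoms_jump_measure)
  finally show ?thesis by simp
qed

lemma w_SBV: "w \<in> SBV I"
  using w_L1 w_BV_deriv cantor_variation_jump_measure by (auto simp: SBV_def)

end

text \<open>The symmetries come from the dependence on \<open>\<bar>t - m\<bar>\<close> alone, and
  strict growth from that of \<open>theta\<close> on the half to the right of
  \<open>m\<close>.\<close>

lemma admissible_data_profile:
  assumes adm: "admissible_data l Q \<omega> \<phi>" and m: "m \<in> {0<..<1}" and s: "s > 0"
  shows "profile (2 * m - 1) 1 m s (theta_m l Q \<omega> m) (\<lambda>t. omega_m \<omega> m (1 - t))"
proof -
  have cont: "continuous_on {0..1} l" "continuous_on {0..1} Q" "continuous_on {0..1} \<omega>"
    and nonneg: "l ` {0..1} \<subseteq> {0..}" "Q ` {0..1} \<subseteq> {0..}" "\<omega> ` {0..1} \<subseteq> {0..}"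
    and zero: "{t \<in> {0..1}. l t = 0} = {0}" "{t \<in> {0..1}. Q t = 0} = {0}" "{t \<in> {0..1}. \<omega> t = 0} = {0}"
    and mono: "strict_mono_on {0..<1} (theta l Q \<omega>)"
    using adm by (auto simp: admissible_data_def)
  have pos: "l t > 0" "Q t > 0" "\<omega> t > 0" if "t \<in> {0<..1}" for t
  proof -
    have "f t > 0" if f: "f ` {0..1} \<subseteq> {0..}" "{t \<in> {0..1}. f t = 0} = {0}" for f :: "real \<Rightarrow> real"
    proof -
      have "t \<notin> {t \<in> {0..1}. f t = 0}"
        using \<open>t \<in> {0<..1}\<close> unfolding f(2) by simp
      then have "f t \<noteq> 0"
        using \<open>t \<in> {0<..1}\<close> by simp
      moreover have "f t \<ge> 0"
        using f(1) \<open>t \<in> {0<..1}\<close> by (auto simp: image_subset_iff)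
      ultimately show ?thesis by simp
    qed
    from this[OF nonneg(1) zero(1)] this[OF nonneg(2) zero(2)] this[OF nonneg(3) zero(3)]
    show "l t > 0" "Q t > 0" "\<omega> t > 0" by auto
  qed
  \<comment> \<open>The argument \<open>m + \<bar>t - m\<bar>\<close> stays in
    \<open>{m..<1}\<close> on the open interval, and there the denominator \<open>Q (1 - t)\<close>
    is positive.\<close>
  have th: "continuous_on {m..<1} (theta l Q \<omega>)"
    unfolding theta_def
  proof (intro continuous_intros)
    show "continuous_on {m..<1} (\<lambda>t. \<omega> (1 - t))" "continuous_on {m..<1} (\<lambda>t. Q (1 - t))"
      using m by (auto intro!: continuous_on_compose2[OF cont(3)] continuous_on_compose2[OF cont(2)] continuous_intros)
    show "continuous_on {m..<1} l"
      using m by (auto intro: continuous_on_subset[OF cont(1)])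
    show "\<forall>t\<in>{m..<1}. Q (1 - t) \<noteq> 0"
      using m pos(2) by (force simp: less_le)
  qed
  show ?thesis
  proof
    show "continuous_on {2 * m - 1<..<1} (theta_m l Q \<omega> m)"
      unfolding theta_m_def using m
      by (intro continuous_on_compose2[OF th] continuous_intros) auto
    show "theta_m l Q \<omega> m (2 * m - t) = theta_m l Q \<omega> m t" for t
    proof -
      have "\<bar>2 * m - t - m\<bar> = \<bar>t - m\<bar>" by simp
      then show ?thesis by (simp only: theta_m_def)
    qed
    show "theta_m l Q \<omega> m x < theta_m l Q \<omega> m y" if "m \<le> x" "x < y" "y < 1" for x y
      using that m by (auto simp: theta_m_def intro!: strict_mono_onD[OF mono])
    show "0 < theta_m l Q \<omega> m m"
      using m pos[of m] pos[of "1 - m"] by (simp add: theta_m_def theta_def)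
    show "continuous_on {2 * m - 1..1} (\<lambda>t. omega_m \<omega> m (1 - t))"
      unfolding omega_m_def using m
      by (intro continuous_on_compose2[OF cont(3)] continuous_intros) auto
    show "omega_m \<omega> m (1 - (2 * m - t)) = omega_m \<omega> m (1 - t)" for t
    proof -
      have "\<bar>1 - (1 - (2 * m - t)) - m\<bar> = \<bar>1 - (1 - t) - m\<bar>" by simp
      then show ?thesis by (simp only: omega_m_def)
    qed
    show "0 < omega_m \<omega> m (1 - t)" if "t \<in> {2 * m - 1<..<1}" for t
      unfolding omega_m_def using that m by (intro pos(3)) auto
  qed (use m s in auto)
qed

theorem theorem2p7:
  fixes l Q \<omega> \<phi> :: "real \<Rightarrow> real" and m s :: real
  assumes "admissible_data l Q \<omega> \<phi>" and "m \<in> {0<..<1}" and "s \<in> {0<..}"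
  shows "\<exists>(w :: real \<Rightarrow> real) g \<mu> \<sigma>.
     w \<in> L1 (interval_m m) \<and>
     sc_G_ms l Q \<omega> m s w = (INF v\<in>L1 (interval_m m). sc_G_ms l Q \<omega> m s v) \<and>
     (\<forall>u\<in>L1 (interval_m m).
        sc_G_ms l Q \<omega> m s u = (INF v\<in>L1 (interval_m m). sc_G_ms l Q \<omega> m s v) \<longrightarrow>
        (AE t in lebesgue_on (interval_m m). u t = w t)) \<and>
     w \<in> SBV (interval_m m) \<and>
     has_BV_deriv (interval_m m) w g \<mu> \<sigma> \<and>
     strict_mono_on (interval_m m) w \<and>
     (AE t in lebesgue_on (interval_m m). w (2 * m - t) = s - w t) \<and>
     trace_right w (2 * m - 1) 0 \<and> trace_left w 1 s \<and>
     (\<exists>\<kappa>\<in>{0<..sqrt (theta l Q \<omega> m)}.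
        (AE t in lebesgue_on (interval_m m). g t = w_deriv_formula l Q \<omega> m \<kappa> t) \<and>
        (\<forall>\<kappa>'\<in>{0<..sqrt (theta l Q \<omega> m)}.
           (AE t in lebesgue_on (interval_m m). g t = w_deriv_formula l Q \<omega> m \<kappa>' t) \<longrightarrow> \<kappa>' = \<kappa>) \<and>
        ((w \<in> W11 (interval_m m) \<and> w m = s / 2) \<or>
         (w \<in> SBV (interval_m m) \<and>
          emeasure (jump_variation \<mu>) (interval_m m - {m}) = 0 \<and>
          \<kappa> = sqrt (theta l Q \<omega> m))))"
proof -
  define A where "A = theta_m l Q \<omega> m"
  define B where "B t = omega_m \<omega> m (1 - t)" for t
  interpret profile "2 * m - 1" 1 m s A B
    unfolding A_def B_def[abs_def] using assms by (intro admissible_data_profile) auto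
  obtain k where sel: "k \<in> {0<..k_max}" "integrable M (slope k)" "(\<integral>t. slope k t \<partial>M) \<le> s"
    "(s - (\<integral>t. slope k t \<partial>M)) * (k_max - k) = 0"
    by (rule exists_slope)
  interpret minimizer "2 * m - 1" 1 m s A B k
    using sel by unfold_locales
  have G: "sc_G_ms l Q \<omega> m s = lsc_envelope I G"
  proof -
    have "G_ms l Q \<omega> m s v = G v" for v
      by (simp only: G_ms_def G_def) (simp add: A_def B_def)
    then have "G_ms l Q \<omega> m s = G"
      by blast
    then show ?thesis
      by (simp add: sc_G_ms_def)
  qed
  have km: "sqrt (theta l Q \<omega> m) = k_max"
    by (simp add: A_def theta_m_def)
  have form: "w_deriv_formula l Q \<omega> m \<kappa> t = slope \<kappa> t" for \<kappa> t
    by (simp only: w_deriv_formula_def slope_def) (simp add: A_def B_def)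
  \<comment> \<open>Without a jump \<open>w\<close> is a primitive; with one, complementarity forces
    the extremal parameter.\<close>
  have alt: "w \<in> W11 I \<and> w m = s / 2 \<or> w \<in> SBV I \<and> emeasure (jump_variation jump_measure) (I - {m}) = 0 \<and> k = k_max"
  proof (cases "jump = 0")
    case True
    then show ?thesis using w_W11 w_mid by simp
  next
    case False
    then show ?thesis
      using w_SBV jump_variation_jump_measure sel(4) by (simp add: jump_def)
  qed
  have uniq: "k' = k" if "k' \<in> {0<..k_max}" "AE t in M. slope k t = slope k' t" for k'
    using slope_inj[OF sel(1) that] by simp
  have sym: "AE t in M. w (2 * m - t) = s - w t"
    using w_sym by (intro AE_I2) auto
  show ?thesis
    unfolding G INF_envelope km form
    by (intro exI[of _ w] exI[of _ "slope k"] exI[of _ jump_measure] exI[of _ "\<lambda>_. 1"] conjI bexI[of _ k])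
      (use w_L1 envelope_w envelope_unique w_SBV w_BV_deriv w_strict_mono sym w_trace_right w_trace_left
        uniq alt sel(1) in auto)
qed

end
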